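(* Let $p\in[1,\infty)$. The sliced Wasserstein distance $\mathrm{SOSW}_p$ is a metric on $\mathcal P(\mathrm{SO}(3))$ that is invariant to rotations, i.e., for any $A\in\mathrm{SO}(3)$ and $\mu,\nu\in\mathcal P(\mathrm{SO}(3))$, $$\mathrm{SOSW}_p^p(\mu(A\,\cdot),\nu(A\,\cdot))=\mathrm{SOSW}_p^p(\mu,\nu).$$
   Context: $\mathcal P(\mathbb X)$ denotes the Borel probability measures on $\mathbb X$. The rotation angle of $Q\in\mathrm{SO}(3)$ is $\angle(Q)=\arccos\frac{\operatorname{trace}(Q)-1}{2}\in[0,\pi]$, and for $Q\in\mathrm{SO}(3)$ the slicing operator is $d_Q\colon\mathrm{SO}(3)\to[0,\pi]$, $d_Q(P)=\angle(Q^\top P)$. For $\mu\in\mathcal P(\mathrm{SO}(3))$ let $\mathcal T_Q\mu=(d_Q)_\#\mu\in\mathcal P([0,\pi])$ (push-forward). $u_{\mathrm{SO}(3)}$ is the rotation-invariant (Haar) probability measure on $\mathrm{SO}(3)$. On $[0,\pi]$ with distance $|x-y|$, $\mathrm W_p^p(\alpha,\beta)=\min_{\pi}\int|x-y|^p\,\mathrm d\pi(x,y)$ over all couplings $\pi$ of $\alpha,\beta$. Define $$\mathrm{SOSW}_p^p(\mu,\nu)=\int_{\mathrm{SO}(3)}\mathrm W_p^p(\mathcal T_Q\mu,\mathcal T_Q\nu)\,\mathrm du_{\mathrm{SO}(3)}(Q).$$ $\mu(A\,\cdot)$ denotes the measure $B\mapsto\mu(AB)$, where $AB=\{AP: P\in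 B\}$. *)

theory Defs
  imports "HOL-Probability.Probability"
begin

section \<open>Rotations and slicing\<close>

definition SO3 :: "(real^3^3) set" where
  "SO3 = {Q. rotation_matrix Q}"

definition rot_angle :: "real^3^3 \<Rightarrow> real" where
  "rot_angle Q = arccos ((trace Q - 1) / 2)"

definition slice :: "real^3^3 \<Rightarrow> real^3^3 \<Rightarrow> real" where
  "slice Q P = rot_angle (transpose Q ** P)"

text \<open>\<open>borel_probs X\<close> has measures whose underlying space is \<open>X\<close> itself, with its subspace Borel sets.\<close>

definition borel_probs :: "'a::topological_space set \<Rightarrow> 'a measure set" where
  "borel_probs X = {\<mu>. prob_space \<mu> \<and> sets \<mu> = sets (restrict_space borel X)}"

definition slice_measure :: "real^3^3 \<Rightarrow> (real^3^3) measure \<Rightarrow> real measure" where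
  "slice_measure Q \<mu> = distr \<mu> (restrict_space borel {0..pi}) (slice Q)"

text \<open>\<open>translate A \<mu>\<close> is the measure \<open>\<mu>(A \<cdot>)\<close>; see \<open>emeasure_translate\<close> below.\<close>

definition translate :: "real^3^3 \<Rightarrow> (real^3^3) measure \<Rightarrow> (real^3^3) measure" where
  "translate A \<mu> = measure_of (space \<mu>) (sets \<mu>) (\<lambda>B. emeasure \<mu> ((\<lambda>P. A ** P) ` B))"


section \<open>The Haar probability measure on the rotation group\<close>

text \<open>
  The definite description is justified by the theorem \<open>ex1_haar\<close> below.  Only invariance under
  translations from the left is demanded; invariance from the right is a consequence.
\<close>

definition is_haar :: "(real^3^3) measure \<Rightarrow> bool" where
  "is_haar u \<longleftrightarrow> u \<in> borel_probs SO3 \<and> (\<forall>A\<in>SO3. translate A u = u)"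

definition haar_SO3 :: "(real^3^3) measure" where
  "haar_SO3 = (THE u. is_haar u)"


section \<open>Wasserstein and sliced Wasserstein distances\<close>

definition couplings :: "'a measure \<Rightarrow> 'b measure \<Rightarrow> ('a \<times> 'b) measure set" where
  "couplings \<alpha> \<beta> = {\<gamma>. prob_space \<gamma> \<and> sets \<gamma> = sets (\<alpha> \<Otimes>\<^sub>M \<beta>)
     \<and> distr \<gamma> \<alpha> fst = \<alpha> \<and> distr \<gamma> \<beta> snd = \<beta>}"

text \<open>
  The suffix \<open>_pow\<close> marks the \<open>p\<close>-th power of a distance.  These powers are extended
  nonnegative numbers; \<open>SOSW_pow_finite\<close> below shows that \<open>enn2real\<close> in \<open>SOSW\<close> is harmless on
  the probability measures on \<open>SO3\<close>.
\<close>

text \<open>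
  On \<open>[0, pi]\<close> the infimum is a minimum.  Couplings of measures on \<open>[0, pi]\<close> live on the square
  \<open>[0, pi] \<times> [0, pi]\<close>, since their sigma-algebra is the product of the two trace sigma-algebras.
\<close>

definition wasserstein_pow :: "real \<Rightarrow> real measure \<Rightarrow> real measure \<Rightarrow> ennreal" where
  "wasserstein_pow p \<alpha> \<beta> =
     (INF \<gamma>\<in>couplings \<alpha> \<beta>. \<integral>\<^sup>+ (x, y). ennreal (\<bar>x - y\<bar> powr p) \<partial>\<gamma>)"

definition SOSW_pow :: "real \<Rightarrow> (real^3^3) measure \<Rightarrow> (real^3^3) measure \<Rightarrow> ennreal" where
  "SOSW_pow p \<mu> \<nu> =
     (\<integral>\<^sup>+ Q. wasserstein_pow p (slice_measure Q \<mu>) (slice_measure Q \<nu>) \<partial>haar_SO3)"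

definition SOSW :: "real \<Rightarrow> (real^3^3) measure \<Rightarrow> (real^3^3) measure \<Rightarrow> real" where
  "SOSW p \<mu> \<nu> = enn2real (SOSW_pow p \<mu> \<nu>) powr (1 / p)"


section \<open>Elementary facts about rotations\<close>

lemma SO3_D: "A \<in> SO3 \<Longrightarrow> rotation_matrix A" "A \<in> SO3 \<Longrightarrow> transpose A ** A = mat 1"
    "A \<in> SO3 \<Longrightarrow> A ** transpose A = mat 1"
  by (auto simp: SO3_def rotation_matrix_def orthogonal_matrix_def)

lemma SO3_one: "mat 1 \<in> SO3"
  by (simp add: SO3_def rotation_matrix_def orthogonal_matrix_id)

lemma SO3_mult: "A \<in> SO3 \<Longrightarrow> B \<in> SO3 \<Longrightarrow> A ** B \<in> SO3"
  by (simp add: SO3_def rotation_matrix_def orthogonal_matrix_mul det_mul)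

lemma SO3_transpose: "A \<in> SO3 \<Longrightarrow> transpose A \<in> SO3"
  by (simp add: SO3_def rotation_matrix_def orthogonal_matrix_transpose)

lemma SO3_cancel:
  assumes "A \<in> SO3"
  shows "transpose A ** (A ** P) = P" "A ** (transpose A ** P) = P"
    "(P ** A) ** transpose A = P" "(P ** transpose A) ** A = P"
  using SO3_D(2,3)[OF assms] by (simp_all add: matrix_mul_assoc)
    (simp_all flip: matrix_mul_assoc)

lemma continuous_on_matrix_mult [continuous_intros]:
  fixes f :: "'a::topological_space \<Rightarrow> real^'n^'m" and g :: "'a \<Rightarrow> real^'k^'n"
  assumes "continuous_on S f" "continuous_on S g"
  shows "continuous_on S (\<lambda>x. f x ** g x)"
  unfolding matrix_matrix_mult_def by (intro continuous_intros assms)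

lemma continuous_on_transpose [continuous_intros]:
  fixes f :: "'a::topological_space \<Rightarrow> real^'n^'m"
  assumes "continuous_on S f"
  shows "continuous_on S (\<lambda>x. transpose (f x))"
  unfolding transpose_def by (intro continuous_intros assms)

lemma continuous_on_trace [continuous_intros]:
  fixes f :: "'a::topological_space \<Rightarrow> real^'n^'n"
  assumes "continuous_on S f"
  shows "continuous_on S (\<lambda>x. trace (f x))"
  unfolding trace_def by (intro continuous_intros assms)

lemma continuous_on_det [continuous_intros]:
  fixes f :: "'a::topological_space \<Rightarrow> real^'n^'n"
  assumes "continuous_on S f"
  shows "continuous_on S (\<lambda>x. det (f x))"
  unfolding det_def by (intro continuous_intros assms)

lemma closed_SO3: "closed SO3"
proof -
  have eq: "SO3 = {Q. transpose Q ** Q = mat 1} \<inter> {Q. Q ** transpose Q = mat 1} \<inter> {Q. det Q = 1}"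
    by (auto simp: SO3_def rotation_matrix_def orthogonal_matrix_def)
  show ?thesis
    unfolding eq by (intro closed_Int closed_Collect_eq continuous_intros)
qed

lemma SO3_borel [measurable]: "SO3 \<in> sets borel"
  by (simp add: closed_SO3)

lemma space_SO3 [simp]: "space (restrict_space borel SO3) = SO3"
  by (simp add: space_restrict_space)

lemma SO3_trace_identity:
  assumes "A \<in> SO3"
  shows "(1 + trace A) * (3 - trace A) =
    (A$1$2 - A$2$1)\<^sup>2 + (A$1$3 - A$3$1)\<^sup>2 + (A$2$3 - A$3$2)\<^sup>2"
proof -
  have rot: "rotation_matrix A"
    using SO3_D(1)[OF assms] .
  have row: "(\<Sum>k\<in>UNIV. A $ i $ k * A $ i $ k) = 1" for i
    using SO3_D(3)[OF assms]
    by (simp add: vec_eq_iff matrix_matrix_mult_def transpose_def mat_def)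
  have mv: "A *v axis j 1 = column j A" for j
    by (rule matrix_vector_mult_basis)
  have cr: "cross3 (column 1 A) (column 2 A) = column 3 A"
    "cross3 (column 2 A) (column 3 A) = column 1 A"
    "cross3 (column 3 A) (column 1 A) = column 2 A"
    by (simp_all flip: mv add: cross_rotation_matrix[OF rot] cross_basis)
  have cof: "A$3$3 = A$1$1 * A$2$2 - A$2$1 * A$1$2"
    "A$1$1 = A$2$2 * A$3$3 - A$3$2 * A$2$3"
    "A$2$2 = A$3$3 * A$1$1 - A$1$3 * A$3$1"
    using cr(1)[THEN arg_cong, of "\<lambda>v. v$3"] cr(2)[THEN arg_cong, of "\<lambda>v. v$1"]
      cr(3)[THEN arg_cong, of "\<lambda>v. v$2"]
    by (simp_all add: cross_components column_def mult.commute)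
  have tr: "trace A = A$1$1 + A$2$2 + A$3$3"
    by (simp add: trace_def sum_3)
  have lin: "L = R" if "L = 3 + 2 * (a + b + c) - (sa + sb + sc) - 2 * (ab + bc + ca)"
    "R = s1 + s2 + s3 + s4 + s5 + s6 - 2 * (x + y + z)"
    "sa + s1 + s3 = 1" "s2 + sb + s5 = 1" "s4 + s6 + sc = 1"
    "c = ab - x" "a = bc - z" "b = ca - y"
    for L R a b c sa sb sc ab bc ca s1 s2 s3 s4 s5 s6 x y z :: real
    using that by argo
  show ?thesis
  proof (rule lin)
    show "(1 + trace A) * (3 - trace A) = 3 + 2 * (A$1$1 + A$2$2 + A$3$3)
      - ((A$1$1)\<^sup>2 + (A$2$2)\<^sup>2 + (A$3$3)\<^sup>2)
      - 2 * (A$1$1 * A$2$2 + A$2$2 * A$3$3 + A$3$3 * A$1$1)"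
      by (simp add: tr power2_eq_square algebra_simps)
    show "(A$1$2 - A$2$1)\<^sup>2 + (A$1$3 - A$3$1)\<^sup>2 + (A$2$3 - A$3$2)\<^sup>2 =
      (A$1$2)\<^sup>2 + (A$2$1)\<^sup>2 + (A$1$3)\<^sup>2 + (A$3$1)\<^sup>2 + (A$2$3)\<^sup>2 + (A$3$2)\<^sup>2
      - 2 * (A$2$1 * A$1$2 + A$1$3 * A$3$1 + A$3$2 * A$2$3)"
      by (simp add: power2_eq_square algebra_simps)
    show "(A$1$1)\<^sup>2 + (A$1$2)\<^sup>2 + (A$1$3)\<^sup>2 = 1"
      "(A$2$1)\<^sup>2 + (A$2$2)\<^sup>2 + (A$2$3)\<^sup>2 = 1"
      "(A$3$1)\<^sup>2 + (A$3$2)\<^sup>2 + (A$3$3)\<^sup>2 = 1"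
      using row[of 1] row[of 2] row[of 3] by (simp_all add: sum_3 power2_eq_square)
  qed (fact cof)+
qed

lemma trace_SO3:
  assumes "A \<in> SO3"
  shows "trace A \<in> {-1..3}"
proof -
  have "0 \<le> (1 + trace A) * (3 - trace A)"
    unfolding SO3_trace_identity[OF assms] by simp
  then show ?thesis
    by (auto simp: zero_le_mult_iff)
qed

lemma rot_angle_SO3:
  assumes "A \<in> SO3"
  shows "rot_angle A \<in> {0..pi}"
  using trace_SO3[OF assms] by (auto simp: rot_angle_def arccos_lbound arccos_ubound)

lemma slice_SO3: "Q \<in> SO3 \<Longrightarrow> P \<in> SO3 \<Longrightarrow> slice Q P \<in> {0..pi}"
  unfolding slice_def by (intro rot_angle_SO3 SO3_mult SO3_transpose)

lemma measurable_slice: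
  assumes "Q \<in> SO3"
  shows "slice Q \<in> restrict_space borel SO3 \<rightarrow>\<^sub>M restrict_space borel {0..pi}"
proof (rule measurable_restrict_space2)
  show "slice Q \<in> space (restrict_space borel SO3) \<rightarrow> {0..pi}"
    using slice_SO3[OF assms] by auto
  have "trace (transpose Q ** P) \<in> {-1..3}" if "P \<in> SO3" for P
    using trace_SO3[OF SO3_mult[OF SO3_transpose[OF assms] that]] .
  then have "continuous_on SO3 (slice Q)"
    unfolding slice_def rot_angle_def
    by (intro continuous_intros) force+
  then show "slice Q \<in> borel_measurable (restrict_space borel SO3)"
    by (rule borel_measurable_continuous_on_restrict)
qed

lemma borel_probs_D:
  assumes "\<mu> \<in> borel_probs X"
  shows "prob_space \<mu>" "sets \<mu> = sets (restrict_space borel X)" "space \<mu> = X"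
  using assms sets_eq_imp_space_eq[of \<mu> "restrict_space borel X"]
  by (auto simp: borel_probs_def space_restrict_space)

lemma slice_measure_in_borel_probs:
  assumes "Q \<in> SO3" "\<mu> \<in> borel_probs SO3"
  shows "slice_measure Q \<mu> \<in> borel_probs {0..pi}"
proof -
  interpret prob_space \<mu> using borel_probs_D[OF assms(2)] by simp
  have "slice Q \<in> \<mu> \<rightarrow>\<^sub>M restrict_space borel {0..pi}"
    using measurable_slice[OF assms(1)] measurable_cong_sets[OF borel_probs_D(2)[OF assms(2)] refl]
    by blast
  then show ?thesis
    by (auto simp: borel_probs_def slice_measure_def intro: prob_space_distr)
qed


section \<open>Translates of measures\<close>

lemma measurable_mult_SO3:
  assumes "A \<in> SO3"
  shows "(\<lambda>P. A ** P) \<in> restrict_space borel SO3 \<rightarrow>\<^sub>M restrict_space borel SO3"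
    and "(\<lambda>P. P ** A) \<in> restrict_space borel SO3 \<rightarrow>\<^sub>M restrict_space borel SO3"
  by (auto intro!: measurable_restrict_space2 borel_measurable_continuous_on_restrict
      continuous_intros SO3_mult assms)

lemma translate_image_eq:
  assumes "A \<in> SO3" "B \<subseteq> SO3"
  shows "(\<lambda>P. A ** P) ` B = (\<lambda>P. transpose A ** P) -` B \<inter> SO3"
proof safe
  fix P assume "P \<in> B"
  then show "A ** P \<in> (\<lambda>P. transpose A ** P) -` B" "A ** P \<in> SO3"
    using assms by (auto simp: SO3_cancel intro: SO3_mult)
next
  fix P assume "transpose A ** P \<in> B"
  then show "P \<in> (\<lambda>P. A ** P) ` B"
    by (rule rev_image_eqI) (simp add: SO3_cancel assms)
qed

lemma translate_eq_distr:
  assumes "A \<in> SO3" "sets \<mu> = sets (restrict_space borel SO3)"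
  shows "translate A \<mu> = distr \<mu> \<mu> (\<lambda>P. transpose A ** P)"
proof -
  have sp: "space \<mu> = SO3"
    using sets_eq_imp_space_eq[OF assms(2)] by simp
  show ?thesis
    unfolding translate_def distr_def
  proof (rule measure_of_eq)
    show "sets \<mu> \<subseteq> Pow (space \<mu>)"
      by (rule sets.space_closed)
    fix B assume "B \<in> sigma_sets (space \<mu>) (sets \<mu>)"
    then have "B \<in> sets \<mu>"
      by (simp only: sets.sigma_sets_eq)
    then have "B \<subseteq> SO3"
      using sets.sets_into_space sp by blast
    then show "emeasure \<mu> ((\<lambda>P. A ** P) ` B) =
        emeasure \<mu> ((\<lambda>P. transpose A ** P) -` B \<inter> space \<mu>)"
      by (simp add: sp translate_image_eq[OF assms(1)])
  qed
qed

lemma measurable_mult_sets_SO3: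
  assumes "A \<in> SO3" "sets \<mu> = sets (restrict_space borel SO3)"
  shows "(\<lambda>P. A ** P) \<in> \<mu> \<rightarrow>\<^sub>M \<mu>" "(\<lambda>P. P ** A) \<in> \<mu> \<rightarrow>\<^sub>M \<mu>"
  using measurable_mult_SO3[OF assms(1)] measurable_cong_sets[OF assms(2) assms(2)] by blast+

lemma emeasure_translate:
  assumes "A \<in> SO3" "sets \<mu> = sets (restrict_space borel SO3)" "B \<in> sets \<mu>"
  shows "emeasure (translate A \<mu>) B = emeasure \<mu> ((\<lambda>P. A ** P) ` B)"
proof -
  have sp: "space \<mu> = SO3"
    using sets_eq_imp_space_eq[OF assms(2)] by simp
  then have "B \<subseteq> SO3"
    using sets.sets_into_space[OF assms(3)] by simp
  then show ?thesis
    unfolding translate_eq_distr[OF assms(1,2)]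
    using measurable_mult_sets_SO3(1)[OF SO3_transpose[OF assms(1)] assms(2)]
    by (simp add: emeasure_distr assms(3) sp translate_image_eq[OF assms(1)])
qed

lemma translate_in_borel_probs:
  assumes "A \<in> SO3" "\<mu> \<in> borel_probs SO3"
  shows "translate A \<mu> \<in> borel_probs SO3"
proof -
  interpret prob_space \<mu> using borel_probs_D[OF assms(2)] by simp
  note s = borel_probs_D(2)[OF assms(2)]
  show ?thesis
    using prob_space_distr[OF measurable_mult_sets_SO3(1)[OF SO3_transpose[OF assms(1)] s]] s
    by (simp add: borel_probs_def translate_eq_distr[OF assms(1) s])
qed

section \<open>Existence and uniqueness of the Haar probability measure\<close>

text \<open>
  Existence: Gram--Schmidt turns a pair of independent vectors into a rotation, equivariantly, so the
  image of a rotation-invariant distribution of pairs is invariant.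
\<close>

definition frame :: "(real^3) \<times> (real^3) \<Rightarrow> real^3^3" where
  "frame = (\<lambda>(x, y). let u = x /\<^sub>R norm x; w = cross3 x y /\<^sub>R norm (cross3 x y)
     in transpose (vector [u, cross3 w u, w]))"

definition indep_pairs :: "((real^3) \<times> (real^3)) set" where
  "indep_pairs = {(x, y). cross3 x y \<noteq> 0}"

lemma rotation_matrix_transpose_vectorI:
  fixes u w :: "real^3"
  assumes "norm u = 1" "norm w = 1" "u \<bullet> w = 0"
  shows "transpose (vector [u, cross3 w u, w]) \<in> SO3"
proof -
  let ?v = "cross3 w u"
  let ?N = "vector [u, ?v, w] :: real^3^3"
  have "(norm ?v)\<^sup>2 = 1"
    using norm_cross_dot[of w u] assms by (simp add: inner_commute)
  then have nv: "norm ?v = 1"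
    by (simp add: abs_square_eq_1)
  have o: "u \<bullet> ?v = 0" "w \<bullet> ?v = 0" "?v \<bullet> u = 0" "?v \<bullet> w = 0" "w \<bullet> u = 0"
    using assms(3) dot_cross_self[of w u] dot_cross_self[of u w] by (auto simp: inner_commute)
  have rows: "row 1 ?N = u" "row 2 ?N = ?v" "row 3 ?N = w"
    by (simp_all add: row_def vec_nth_inverse)
  have orth: "orthogonal_matrix ?N"
    unfolding orthogonal_matrix_orthonormal_rows forall_3 rows
    by (simp add: assms nv o orthogonal_def)
  have "cross3 ?v w = u"
  proof -
    have "cross3 ?v w = - cross3 w ?v"
      by (rule cross_skew)
    also have "\<dots> = - ((w \<bullet> u) *\<^sub>R w - (w \<bullet> w) *\<^sub>R u)"
      by (simp add: Lagrange)
    also have "\<dots> = u"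
      using assms by (simp add: o flip: power2_norm_eq_inner)
    finally show ?thesis .
  qed
  then have "det ?N = 1"
    using assms(1) by (simp only: flip: dot_cross_det) (simp flip: power2_norm_eq_inner)
  with orth show ?thesis
    by (simp add: SO3_def rotation_matrix_def orthogonal_matrix_transpose)
qed

lemma frame_SO3:
  assumes "z \<in> indep_pairs"
  shows "frame z \<in> SO3"
proof -
  obtain x y where z: "z = (x, y)" by (cases z)
  with assms have "cross3 x y \<noteq> 0" by (simp add: indep_pairs_def)
  moreover from this have "x \<noteq> 0" by auto
  ultimately show ?thesis
    unfolding frame_def z Let_def prod.case
    by (intro rotation_matrix_transpose_vectorI) (simp_all add: dot_cross_self)
qed

lemma SO3_preserves:
  assumes "A \<in> SO3"
  shows "norm (A *v x) = norm x" "cross3 (A *v x) (A *v y) = A *v cross3 x y"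
    "orthogonal_transformation (\<lambda>x. A *v x)"
proof -
  show o: "orthogonal_transformation (\<lambda>x. A *v x)"
    using assms unfolding orthogonal_transformation_matrix
    by (simp add: SO3_def rotation_matrix_def)
  show "norm (A *v x) = norm x"
    using orthogonal_transformation_norm[OF o] .
  show "cross3 (A *v x) (A *v y) = A *v cross3 x y"
    using assms by (simp add: cross_rotation_matrix SO3_def)
qed

lemma matrix_mult_transpose_vector:
  fixes A :: "real^3^3"
  shows "A ** transpose (vector [u, v, w] :: real^3^3) = transpose (vector [A *v u, A *v v, A *v w])"
  by (simp add: vec_eq_iff forall_3 matrix_matrix_mult_def matrix_vector_mult_def transpose_def)

lemma frame_equivariant:
  assumes "A \<in> SO3"
  shows "frame (A *v x, A *v y) = A ** frame (x, y)"
proof -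
  have [simp]: "A *v (c *\<^sub>R z) = c *\<^sub>R (A *v z)" for c z
    by (simp add: matrix_vector_mult_scaleR)
  show ?thesis
    by (simp add: frame_def Let_def SO3_preserves[OF assms] matrix_mult_transpose_vector
        cross_mult_left cross_mult_right)
qed

lemma open_indep_pairs: "open indep_pairs"
proof -
  have "continuous_on UNIV (\<lambda>z. cross3 (fst z) (snd z))"
    by (intro continuous_on_cross continuous_intros)
  then show ?thesis
    unfolding indep_pairs_def case_prod_beta
    by (intro open_Collect_neq) (auto intro: continuous_intros)
qed

lemma continuous_on_frame: "continuous_on indep_pairs frame"
proof -
  have nz: "cross3 (fst z) (snd z) \<noteq> 0" "fst z \<noteq> 0" if "z \<in> indep_pairs" for z
    using that by (auto simp: indep_pairs_def)
  have vec3: "continuous_on S (\<lambda>z. vector [f z, g z, h z] :: real^3^3)"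
    if "continuous_on S f" "continuous_on S g" "continuous_on S h"
    for S :: "((real^3) \<times> (real^3)) set" and f g h
  proof -
    have "continuous_on S (\<lambda>z. (vector [f z, g z, h z] :: real^3^3) $ i)" for i
      using exhaust_3[of i] that by auto
    then have "continuous_on S (\<lambda>z. \<chi> i. (vector [f z, g z, h z] :: real^3^3) $ i)"
      by (rule continuous_on_vec_lambda)
    then show ?thesis
      unfolding vec_lambda_eta .
  qed
  show ?thesis
    unfolding frame_def case_prod_beta Let_def
    by (intro continuous_on_transpose vec3 continuous_intros continuous_on_cross)
      (use nz in auto)
qed

lemma lborel_distr_SO3:
  assumes "A \<in> SO3"
  shows "distr lborel borel (\<lambda>x. A *v x) = lborel"
proof (rule lborel_eqI[symmetric])
  have meas: "(\<lambda>x. A *v x) \<in> borel_measurable borel"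
    by (intro borel_measurable_continuous_onI matrix_vector_mult_linear_continuous_on)
  fix l u :: "real^3" assume lu: "\<And>b. b \<in> Basis \<Longrightarrow> l \<bullet> b \<le> u \<bullet> b"
  let ?T = "\<lambda>x. transpose A *v x"
  have T: "orthogonal_transformation ?T"
    by (rule SO3_preserves(3)[OF SO3_transpose[OF assms]])
  have inv: "A *v ?T x = x" "?T (A *v x) = x" for x
    using SO3_D(2,3)[OF assms] by (metis matrix_vector_mul_assoc matrix_vector_mul_lid)+
  have im: "(\<lambda>x. A *v x) -` box l u = ?T ` box l u"
  proof (intro equalityI subsetI)
    fix x assume "x \<in> (\<lambda>x. A *v x) -` box l u"
    then show "x \<in> ?T ` box l u"
      using inv(2)[of x] by (metis imageI vimageD)
  next
    fix x assume "x \<in> ?T ` box l u"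
    then show "x \<in> (\<lambda>x. A *v x) -` box l u"
      using inv(1) by (metis imageE vimageI)
  qed
  have fm: "?T ` box l u \<in> lmeasurable"
    by (rule measurable_orthogonal_image[OF T]) simp
  have bor: "(\<lambda>x. A *v x) -` box l u \<in> sets borel"
    using measurable_sets[OF meas, of "box l u"] by simp
  have "emeasure (distr lborel borel (\<lambda>x. A *v x)) (box l u) = emeasure lborel (?T ` box l u)"
    using meas by (simp add: emeasure_distr im)
  also have "\<dots> = emeasure lebesgue (?T ` box l u)"
    using bor by (simp add: im)
  also have "\<dots> = measure lebesgue (?T ` box l u)"
    using fm by (rule emeasure_eq_measure2)
  also have "\<dots> = measure lebesgue (box l u)"
    by (subst measure_orthogonal_image[OF T]) auto
  also have "\<dots> = (\<Prod>b\<in>Basis. (u - l) \<bullet> b)"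
    using lu by (simp add: measure_lborel_box)
  finally show "emeasure (distr lborel borel (\<lambda>x. A *v x)) (box l u) = (\<Prod>b\<in>Basis. (u - l) \<bullet> b)" .
qed simp

lemma lborel_pair_distr_SO3:
  assumes "A \<in> SO3"
  shows "distr lborel borel (\<lambda>(x, y). (A *v x, A *v y)) = lborel"
proof -
  have [measurable]: "(\<lambda>x. A *v x) \<in> borel_measurable borel"
    by (intro borel_measurable_continuous_onI matrix_vector_mult_linear_continuous_on)
  have "distr (lborel \<Otimes>\<^sub>M lborel) (borel \<Otimes>\<^sub>M borel) (\<lambda>(x, y). (A *v x, A *v y))
      = distr lborel borel (\<lambda>x. A *v x) \<Otimes>\<^sub>M distr lborel borel (\<lambda>x. A *v x)"
    by (rule pair_measure_distr[symmetric])
      (simp_all add: lborel_distr_SO3[OF assms] sigma_finite_lborel)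
  then show ?thesis
    by (simp add: lborel_distr_SO3[OF assms] lborel_prod borel_prod)
qed

theorem ex_haar: "\<exists>u. is_haar u"
proof -
  define K where "K = indep_pairs \<inter> ball 0 1"
  define f where "f = (\<lambda>z. if z \<in> indep_pairs then frame z else mat 1)"
  define V where "V = uniform_measure lborel K"
  define u where "u = distr V (restrict_space borel SO3) f"
  have opK: "open K"
    by (simp add: K_def open_indep_pairs open_Int)
  then have K [measurable]: "K \<in> sets borel" by simp
  have "(axis 1 (1/2), axis 2 (1/2)) \<in> K"
  proof -
    have "cross3 (axis 1 (1/2)) (axis 2 (1/2) :: real^3) \<noteq> 0"
      by (simp add: cross3_simps axis_def)
    moreover have "norm (axis 1 (1/2) :: real^3, axis 2 (1/2) :: real^3) < 1"
      by (simp add: norm_Pair norm_eq_sqrt_inner inner_axis_axis)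
    ultimately show ?thesis
      by (simp add: K_def indep_pairs_def)
  qed
  with opK have K0: "emeasure lborel K \<noteq> 0"
    using open_not_negligible[of K] by (auto simp: negligible_iff_emeasure0 K)
  have "emeasure lborel K \<le> emeasure lborel (ball 0 1 :: ((real^3) \<times> (real^3)) set)"
    by (intro emeasure_mono) (auto simp: K_def)
  then have Kfin: "emeasure lborel K \<noteq> \<infinity>"
    using emeasure_lborel_ball_finite[of "0::(real^3) \<times> (real^3)" 1] by (auto simp: top_unique)
  have V: "prob_space V" "sets V = sets borel" "space V = UNIV"
    using K0 Kfin by (auto simp: V_def intro!: prob_space_uniform_measure simp: space_uniform_measure)
  have fS: "f z \<in> SO3" for z
    by (simp add: f_def frame_SO3 SO3_one)
  have "f \<in> borel_measurable borel"
    unfolding f_def using open_indep_pairs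
    by (intro borel_measurable_continuous_on_if continuous_on_frame continuous_intros) auto
  then have fm: "f \<in> V \<rightarrow>\<^sub>M restrict_space borel SO3"
    using fS V by (intro measurable_restrict_space2) (auto cong: measurable_cong_sets)
  have u: "u \<in> borel_probs SO3"
    using prob_space.prob_space_distr[OF V(1) fm] by (simp add: u_def borel_probs_def)
  have "translate A u = u" if A: "A \<in> SO3" for A
  proof (rule measure_eqI)
    show "sets (translate A u) = sets u"
      using borel_probs_D(2)[OF translate_in_borel_probs[OF A u]] borel_probs_D(2)[OF u] by simp
    fix B assume "B \<in> sets (translate A u)"
    then have B: "B \<in> sets (restrict_space borel SO3)"
      using borel_probs_D(2)[OF translate_in_borel_probs[OF A u]] by simp
    then have BS: "B \<subseteq> SO3" using sets.sets_into_space by fastforce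
    let ?T = "\<lambda>(x, y). (transpose A *v x, transpose A *v y)"
    have At: "transpose A \<in> SO3" using A by (rule SO3_transpose)
    have AB: "(\<lambda>P. A ** P) ` B \<in> sets (restrict_space borel SO3)"
      unfolding translate_image_eq[OF A BS]
      using measurable_sets[OF measurable_mult_SO3(1)[OF At] B] by simp
    have val: "emeasure u C = emeasure lborel (K \<inter> f -` C) / emeasure lborel K"
      "K \<inter> f -` C \<in> sets borel"
      if "C \<in> sets (restrict_space borel SO3)" for C
    proof -
      have *: "f -` C \<in> sets borel"
        using measurable_sets[OF fm that] V by simp
      then show "K \<inter> f -` C \<in> sets borel" by simp
      show "emeasure u C = emeasure lborel (K \<inter> f -` C) / emeasure lborel K"
        using * by (simp add: u_def emeasure_distr[OF fm that] V(3)) (simp add: V_def K)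
    qed
    have Tm: "?T \<in> borel_measurable borel"
      unfolding case_prod_beta
      by (intro borel_measurable_continuous_onI continuous_intros
          matrix_vector_mult_linear_continuous_on
          continuous_on_compose2[OF matrix_vector_mult_linear_continuous_on[of UNIV]]) auto
    have ind: "?T z \<in> indep_pairs \<longleftrightarrow> z \<in> indep_pairs" for z
      using SO3_preserves(1)[OF At, of "cross3 (fst z) (snd z)"]
      unfolding indep_pairs_def case_prod_beta mem_Collect_eq fst_conv snd_conv
        SO3_preserves(2)[OF At]
      by (metis norm_eq_zero)
    have ball: "?T z \<in> ball 0 1 \<longleftrightarrow> z \<in> ball 0 1" for z
      by (cases z) (simp only: norm_Pair SO3_preserves(1)[OF At] mem_ball_0 prod.case)
    have KT: "?T z \<in> K \<longleftrightarrow> z \<in> K" for z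
      unfolding K_def using ind[of z] ball[of z] by blast
    have fT: "f (?T z) = transpose A ** f z" if "z \<in> K" for z
    proof -
      from that have z: "z \<in> indep_pairs" "?T z \<in> indep_pairs"
        using ind[of z] by (auto simp: K_def)
      obtain x y where "z = (x, y)" by (cases z)
      show ?thesis
        using z unfolding \<open>z = (x, y)\<close> prod.case f_def
        by (simp only: if_True frame_equivariant[OF At])
    qed
    have "K \<inter> f -` ((\<lambda>P. A ** P) ` B) = ?T -` (K \<inter> f -` B)"
    proof (rule set_eqI)
      fix z
      show "z \<in> K \<inter> f -` ((\<lambda>P. A ** P) ` B) \<longleftrightarrow> z \<in> ?T -` (K \<inter> f -` B)"
        unfolding translate_image_eq[OF A BS] Int_iff vimage_eq
        using KT[of z] fT[of z] fS[of z] by metis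
    qed
    moreover have "emeasure lborel (?T -` (K \<inter> f -` B)) = emeasure lborel (K \<inter> f -` B)"
    proof -
      have "emeasure lborel (K \<inter> f -` B) = emeasure (distr lborel borel ?T) (K \<inter> f -` B)"
        by (simp only: lborel_pair_distr_SO3[OF At])
      also have "\<dots> = emeasure lborel (?T -` (K \<inter> f -` B))"
        using Tm val(2)[OF B] by (simp add: emeasure_distr)
      finally show ?thesis ..
    qed
    ultimately have "emeasure u ((\<lambda>P. A ** P) ` B) = emeasure u B"
      by (simp add: val B AB)
    then show "emeasure (translate A u) B = emeasure u B"
      using emeasure_translate[OF A borel_probs_D(2)[OF u]] B borel_probs_D(2)[OF u] by simp
  qed
  with u show ?thesis
    unfolding is_haar_def by blast
qed

text \<open>
  Uniqueness: a left-invariant measure agrees with the inverse image of any other one, by Fubini.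
\<close>

lemma haar_eq_transpose:
  assumes u: "is_haar u" and v: "is_haar v"
  shows "u = distr v (restrict_space borel SO3) transpose"
proof (rule measure_eqI)
  let ?S = "restrict_space borel SO3 :: (real^3^3) measure"
  have up: "u \<in> borel_probs SO3" and vp: "v \<in> borel_probs SO3"
    using u v by (auto simp: is_haar_def)
  interpret U: prob_space u using borel_probs_D[OF up] by simp
  interpret V: prob_space v using borel_probs_D[OF vp] by simp
  interpret UV: pair_prob_space v u ..
  note su = borel_probs_D(2)[OF up] and sv = borel_probs_D(2)[OF vp]
  note spu = borel_probs_D(3)[OF up] and spv = borel_probs_D(3)[OF vp]
  have tm: "transpose \<in> ?S \<rightarrow>\<^sub>M ?S"
    by (auto intro!: measurable_restrict_space2 borel_measurable_continuous_on_restrict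
        continuous_intros SO3_transpose)
  then have tmv: "transpose \<in> v \<rightarrow>\<^sub>M ?S"
    using measurable_cong_sets[OF sv refl] by blast
  show "sets u = sets (distr v ?S transpose)"
    using su by simp
  fix B assume "B \<in> sets u"
  then have B: "B \<in> sets ?S" and Bu: "B \<in> sets u" using su by auto
  have inv: "emeasure w {P \<in> SO3. A ** P \<in> C} = emeasure w C"
    if w: "is_haar w" and A: "A \<in> SO3" and C: "C \<in> sets ?S" for w A C
  proof -
    have wp: "w \<in> borel_probs SO3" using w by (simp add: is_haar_def)
    have CS: "C \<subseteq> SO3" using C sets.sets_into_space by fastforce
    have At: "transpose A \<in> SO3" using A by (rule SO3_transpose)
    have "emeasure w C = emeasure (translate (transpose A) w) C"
      using w At by (simp add: is_haar_def)
    also have "\<dots> = emeasure w ((\<lambda>P. transpose A ** P) ` C)"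
      using emeasure_translate[OF At borel_probs_D(2)[OF wp]] C borel_probs_D(2)[OF wp] by simp
    also have "(\<lambda>P. transpose A ** P) ` C = {P \<in> SO3. A ** P \<in> C}"
      unfolding translate_image_eq[OF At CS] by auto
    finally show ?thesis ..
  qed
  have mB: "(\<lambda>(Q, P). indicator B (transpose Q ** P) :: ennreal) \<in> borel_measurable (v \<Otimes>\<^sub>M u)"
  proof -
    have "(\<lambda>z. transpose (fst z) ** snd z) \<in> borel_measurable (v \<Otimes>\<^sub>M u)"
    proof (rule borel_measurable_continuous_Pair[where H = "\<lambda>Q P. transpose Q ** P"])
      have "fst \<in> v \<Otimes>\<^sub>M u \<rightarrow>\<^sub>M ?S" "snd \<in> v \<Otimes>\<^sub>M u \<rightarrow>\<^sub>M ?S"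
        using measurable_cong_sets[OF refl su] measurable_cong_sets[OF refl sv]
          measurable_fst[of v u] measurable_snd[of v u] by blast+
      then show "fst \<in> borel_measurable (v \<Otimes>\<^sub>M u)" "snd \<in> borel_measurable (v \<Otimes>\<^sub>M u)"
        by (auto simp: measurable_restrict_space2_iff)
    qed (intro continuous_intros)
    then have "(\<lambda>z. transpose (fst z) ** snd z) \<in> v \<Otimes>\<^sub>M u \<rightarrow>\<^sub>M ?S"
      by (intro measurable_restrict_space2)
        (auto simp: space_pair_measure spu spv SO3_mult SO3_transpose)
    then show ?thesis
      unfolding case_prod_beta
      by (rule measurable_compose) (use B in \<open>simp add: borel_measurable_indicator\<close>)
  qed
  have "(\<integral>\<^sup>+ Q. (\<integral>\<^sup>+ P. indicator B (transpose Q ** P) \<partial>u) \<partial>v) = (\<integral>\<^sup>+ Q. emeasure u B \<partial>v)"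
  proof (rule nn_integral_cong)
    fix Q assume "Q \<in> space v"
    then have Q: "transpose Q \<in> SO3" using spv by (simp add: SO3_transpose)
    have "{P \<in> SO3. transpose Q ** P \<in> B} \<in> sets u"
      using measurable_sets[OF measurable_mult_SO3(1)[OF Q] B] su
      by (simp add: vimage_def Int_def conj_commute)
    then have "emeasure u {P \<in> SO3. transpose Q ** P \<in> B}
        = (\<integral>\<^sup>+ P. indicator {P \<in> SO3. transpose Q ** P \<in> B} P \<partial>u)"
      by simp
    also have "\<dots> = (\<integral>\<^sup>+ P. indicator B (transpose Q ** P) \<partial>u)"
      by (intro nn_integral_cong) (auto simp: spu split: split_indicator)
    finally show "(\<integral>\<^sup>+ P. indicator B (transpose Q ** P) \<partial>u) = emeasure u B"
      using inv[OF u Q B] by simp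
  qed
  also have "\<dots> = emeasure u B"
    by (simp add: V.emeasure_space_1)
  finally have 1: "(\<integral>\<^sup>+ Q. (\<integral>\<^sup>+ P. indicator B (transpose Q ** P) \<partial>u) \<partial>v) = emeasure u B" .
  let ?B' = "{Q \<in> SO3. transpose Q \<in> B}"
  have B': "?B' \<in> sets ?S"
    using measurable_sets[OF tm B] by (simp add: vimage_def Int_def conj_commute)
  have "(\<integral>\<^sup>+ P. (\<integral>\<^sup>+ Q. indicator B (transpose Q ** P) \<partial>v) \<partial>u) = (\<integral>\<^sup>+ P. emeasure v ?B' \<partial>u)"
  proof (rule nn_integral_cong)
    fix P assume "P \<in> space u"
    then have P: "P \<in> SO3" "transpose P \<in> SO3" using spu by (simp_all add: SO3_transpose)
    have "{Q \<in> SO3. transpose P ** Q \<in> ?B'} \<in> sets v"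
      using measurable_sets[OF measurable_mult_SO3(1)[OF P(2)] B'] sv
      by (simp add: vimage_def Int_def conj_commute)
    then have "emeasure v {Q \<in> SO3. transpose P ** Q \<in> ?B'}
        = (\<integral>\<^sup>+ Q. indicator {Q \<in> SO3. transpose P ** Q \<in> ?B'} Q \<partial>v)"
      by simp
    also have "\<dots> = (\<integral>\<^sup>+ Q. indicator B (transpose Q ** P) \<partial>v)"
      using P by (intro nn_integral_cong)
        (auto simp: spv matrix_transpose_mul SO3_mult split: split_indicator)
    finally show "(\<integral>\<^sup>+ Q. indicator B (transpose Q ** P) \<partial>v) = emeasure v ?B'"
      using inv[OF v P(2) B'] by simp
  qed
  also have "\<dots> = emeasure v ?B'"
    by (simp add: U.emeasure_space_1)
  also have "\<dots> = emeasure (distr v ?S transpose) B"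
    using B by (simp add: emeasure_distr[OF tmv] spv vimage_def Int_def conj_commute)
  finally show "emeasure u B = emeasure (distr v ?S transpose) B"
    using 1 UV.Fubini'[OF mB] by simp
qed

theorem ex1_haar: "\<exists>!u. is_haar u"
  using ex_haar haar_eq_transpose by metis

corollary is_haar_haar_SO3: "is_haar haar_SO3"
  unfolding haar_SO3_def by (rule theI'[OF ex1_haar])


section \<open>Finiteness\<close>

lemma pair_measure_coupling:
  assumes "prob_space \<alpha>" "prob_space \<beta>"
  shows "\<alpha> \<Otimes>\<^sub>M \<beta> \<in> couplings \<alpha> \<beta>"
proof -
  interpret A: prob_space \<alpha> by fact
  interpret B: prob_space \<beta> by fact
  interpret AB: pair_prob_space \<alpha> \<beta> ..
  have "distr (\<alpha> \<Otimes>\<^sub>M \<beta>) \<alpha> fst = \<alpha>"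
    by (rule B.distr_pair_fst)
  moreover have "distr (\<alpha> \<Otimes>\<^sub>M \<beta>) \<beta> snd = \<beta>"
  proof (rule measure_eqI)
    fix C assume "C \<in> sets (distr (\<alpha> \<Otimes>\<^sub>M \<beta>) \<beta> snd)"
    then have C: "C \<in> sets \<beta>" by simp
    then have "snd -` C \<inter> space (\<alpha> \<Otimes>\<^sub>M \<beta>) = space \<alpha> \<times> C"
      using sets.sets_into_space by (fastforce simp: space_pair_measure)
    then show "emeasure (distr (\<alpha> \<Otimes>\<^sub>M \<beta>) \<beta> snd) C = emeasure \<beta> C"
      using C by (simp add: emeasure_distr B.emeasure_pair_measure_Times A.emeasure_space_1)
  qed simp
  ultimately show ?thesis
    by (simp add: couplings_def AB.P.prob_space_axioms)
qed

lemma wasserstein_pow_le: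
  assumes "0 \<le> p" "\<alpha> \<in> borel_probs {0..pi}" "\<beta> \<in> borel_probs {0..pi}"
  shows "wasserstein_pow p \<alpha> \<beta> \<le> ennreal (pi powr p)"
proof -
  interpret A: prob_space \<alpha> using borel_probs_D[OF assms(2)] by simp
  interpret B: prob_space \<beta> using borel_probs_D[OF assms(3)] by simp
  interpret AB: pair_prob_space \<alpha> \<beta> ..
  have "wasserstein_pow p \<alpha> \<beta> \<le> (\<integral>\<^sup>+ (x, y). ennreal (\<bar>x - y\<bar> powr p) \<partial>(\<alpha> \<Otimes>\<^sub>M \<beta>))"
    unfolding wasserstein_pow_def
    by (intro INF_lower pair_measure_coupling A.prob_space_axioms B.prob_space_axioms)
  also have "\<dots> \<le> (\<integral>\<^sup>+ z. ennreal (pi powr p) \<partial>(\<alpha> \<Otimes>\<^sub>M \<beta>))"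
    using assms(1) borel_probs_D(3)[OF assms(2)] borel_probs_D(3)[OF assms(3)]
    by (intro nn_integral_mono)
      (auto simp: space_pair_measure intro!: ennreal_leI powr_mono2)
  also have "\<dots> = ennreal (pi powr p)"
    by (simp add: AB.P.emeasure_space_1)
  finally show ?thesis .
qed

lemma SOSW_pow_finite:
  assumes "0 \<le> p" "\<mu> \<in> borel_probs SO3" "\<nu> \<in> borel_probs SO3"
  shows "SOSW_pow p \<mu> \<nu> < \<infinity>"
proof -
  have h: "haar_SO3 \<in> borel_probs SO3"
    using is_haar_haar_SO3 by (simp add: is_haar_def)
  interpret prob_space haar_SO3 using borel_probs_D[OF h] by simp
  have "SOSW_pow p \<mu> \<nu> \<le> (\<integral>\<^sup>+ Q. ennreal (pi powr p) \<partial>haar_SO3)"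
    unfolding SOSW_pow_def using borel_probs_D(3)[OF h]
    by (intro nn_integral_mono wasserstein_pow_le assms slice_measure_in_borel_probs) auto
  also have "\<dots> < \<infinity>"
    by (simp add: emeasure_space_1)
  finally show ?thesis .
qed

end

theory Submission
  imports Defs
begin

text \<open>
  Rotation invariance: slicing \<open>\<mu>(A \<cdot>)\<close> in direction \<open>Q\<close> is the same as slicing \<open>\<mu>\<close> in direction
  \<open>A ** Q\<close> (\<open>slice_measure_translate\<close>), and the substitution \<open>Q \<mapsto> A ** Q\<close> preserves Haar measure.

  Triangle inequality: for powers of distances, the triangle inequality for the roots is equivalent to
  the family of inequalities \<open>a \<le> l powr (1 - p) * b + (1 - l) powr (1 - p) * c\<close> with \<open>0 < l < 1\<close>
  (\<open>powr_add_le\<close> and \<open>powr_inverse_triangleI\<close>).  These are linear, so they pass from the cost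
  \<open>\<bar>x - y\<bar> powr p\<close> to integrals against couplings and then to integrals over the slicing direction.
  For the passage to couplings, a coupling of \<open>\<alpha>\<close> and \<open>\<beta>\<close> has to be glued to one of \<open>\<beta>\<close> and \<open>\<delta>\<close>; it
  is enough to do so approximately, along a partition of the interval into short cells
  (\<open>coupling_with_equal_labels\<close>, \<open>wasserstein_pow_triangle\<close>).  The integrand of the sliced distance is
  measurable because the Wasserstein distance of the slices depends continuously on the direction
  (\<open>continuous_on_wasserstein_slice\<close>).

  Definiteness: if the sliced distance vanishes, then for almost every direction \<open>Q\<close> the slices of
  \<open>\<mu>\<close> and \<open>\<nu>\<close> have Wasserstein distance zero and hence coincide (\<open>wasserstein_pow_eq_0D\<close>).  The rotation
  angle of \<open>transpose Q ** P\<close> is a strictly increasing function of the Euclidean distance of \<open>Q\<close> and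
  \<open>P\<close> (\<open>dist_SO3_eq_slice\<close>), so \<open>\<mu>\<close> and \<open>\<nu>\<close> agree on all balls around almost every \<open>Q\<close>.  Balls of equal
  radius have equal positive Haar measure, and averaging over the centres with Fubini's theorem then
  yields \<open>\<mu> = \<nu>\<close> (\<open>borel_probs_SO3_eqI_balls\<close>).
\<close>


section \<open>Weighted forms of the triangle inequality\<close>

text \<open>
  For a fixed weight \<open>l\<close> this is a linear substitute for the triangle inequality of
  the \<open>p\<close>-norm: it can be integrated against any measure, and no root has to be taken before the
  end.
\<close>

lemma powr_add_le:
  fixes a b l p :: real
  assumes "1 \<le> p" "0 \<le> a" "0 \<le> b" "0 < l" "l < 1"
  shows "(a + b) powr p \<le> l powr (1 - p) * a powr p + (1 - l) powr (1 - p) * b powr p"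
proof -
  have scale: "t * (x / t) powr p = t powr (1 - p) * x powr p" if "0 < t" "0 \<le> x" for t x :: real
    using that by (simp add: powr_divide powr_diff)
  have mono: "x powr p \<le> t powr (1 - p) * x powr p" if "0 < t" "t < 1" for t x :: real
    using that powr_mono'[of "1 - p" 0 t] assms(1)
      mult_right_mono[of 1 "t powr (1 - p)" "x powr p"] by auto
  consider "a = 0" | "b = 0" | "0 < a" "0 < b" using assms(2,3) by linarith
  then show ?thesis
  proof cases
    case 3
    \<comment> \<open>\<open>a + b\<close> is the convex combination of \<open>a / l\<close> and \<open>b / (1 - l)\<close> with weights \<open>l\<close> and \<open>1 - l\<close>.\<close>
    have "(a + b) powr p = ((1 - l) *\<^sub>R (b / (1 - l)) + l *\<^sub>R (a / l)) powr p"
      using assms(4,5) by (simp add: add.commute)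
    also have "\<dots> \<le> (1 - l) * (b / (1 - l)) powr p + l * (a / l) powr p"
      using 3 assms by (intro convex_onD[OF powr_convex[OF assms(1)]]) auto
    finally show ?thesis
      using scale[of l a] scale[of "1 - l" b] assms by simp
  qed (use mono[of "1 - l" b] mono[of l a] assms in auto)
qed

text \<open>
  Optimising the weight recovers the triangle inequality for the \<open>p\<close>-th roots.  This plays the
  part of Minkowski's inequality.
\<close>

lemma powr_inverse_triangleI:
  fixes a b c p :: real
  assumes p: "1 \<le> p" and nonneg: "0 \<le> a" "0 \<le> b" "0 \<le> c"
    and le: "\<And>l. 0 < l \<Longrightarrow> l < 1 \<Longrightarrow> a \<le> l powr (1 - p) * b + (1 - l) powr (1 - p) * c"
  shows "a powr (1 / p) \<le> b powr (1 / p) + c powr (1 / p)"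
proof (rule field_le_epsilon)
  fix e :: real assume "0 < e"
  \<comment> \<open>The optimal \<open>l\<close> is the share of \<open>b powr (1/p)\<close> in the sum; the slack \<open>e\<close> keeps it strictly between 0 and 1.\<close>
  define B C where "B = b powr (1 / p) + e / 2" and "C = c powr (1 / p) + e / 2"
  have pos: "0 < B" "0 < C"
    using \<open>0 < e\<close> by (auto simp: B_def C_def intro: add_nonneg_pos)
  define l where "l = B / (B + C)"
  have l: "0 < l" "l < 1" "1 - l = C / (B + C)"
    using pos by (auto simp: l_def field_simps)
  have root: "x \<le> X powr p" if "0 \<le> x" "x powr (1 / p) \<le> X" for x X
  proof -
    have "x = (x powr (1 / p)) powr p"
      using p that by (simp add: powr_powr)
    also have "\<dots> \<le> X powr p"
      using p that by (intro powr_mono2) auto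
    finally show ?thesis .
  qed
  have share: "(X / (B + C)) powr (1 - p) * X powr p = X * (B + C) powr (p - 1)" if "0 < X" for X
  proof -
    have "(X / (B + C)) powr (1 - p) * X powr p = (X powr (1 - p) * X powr p) / (B + C) powr (1 - p)"
      using pos that by (simp add: powr_divide)
    also have "X powr (1 - p) * X powr p = X"
      using that by (simp flip: powr_add)
    also have "X / (B + C) powr (1 - p) = X * (B + C) powr (p - 1)"
      using powr_minus_divide[of "B + C" "1 - p"] by simp
    finally show ?thesis .
  qed
  have "a \<le> l powr (1 - p) * b + (1 - l) powr (1 - p) * c"
    by (rule le[OF l(1,2)])
  also have "\<dots> \<le> l powr (1 - p) * B powr p + (1 - l) powr (1 - p) * C powr p"
    using \<open>0 < e\<close> nonneg by (intro add_mono mult_left_mono root) (auto simp: B_def C_def)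
  also have "\<dots> = B * (B + C) powr (p - 1) + C * (B + C) powr (p - 1)"
    unfolding l(3) using share[OF pos(1)] share[OF pos(2)] by (simp only: l_def)
  also have "\<dots> = (B + C) powr 1 * (B + C) powr (p - 1)"
    using pos by (simp add: distrib_right)
  also have "\<dots> = (B + C) powr p"
    unfolding powr_add[symmetric] by simp
  finally have "a powr (1 / p) \<le> ((B + C) powr p) powr (1 / p)"
    using p nonneg by (intro powr_mono2) auto
  also have "\<dots> = B + C"
    using p pos by (simp add: powr_powr)
  finally show "a powr (1 / p) \<le> b powr (1 / p) + c powr (1 / p) + e"
    by (simp add: B_def C_def)
qed

lemma enn2real_powr_triangleI:
  fixes a b c :: ennreal
  assumes p: "1 \<le> p" and fin: "a < \<infinity>" "b < \<infinity>" "c < \<infinity>"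
    and le: "\<And>l. 0 < l \<Longrightarrow> l < 1 \<Longrightarrow>
      a \<le> ennreal (l powr (1 - p)) * b + ennreal ((1 - l) powr (1 - p)) * c"
  shows "enn2real a powr (1 / p) \<le> enn2real b powr (1 / p) + enn2real c powr (1 / p)"
proof (rule powr_inverse_triangleI[OF p])
  fix l :: real assume l: "0 < l" "l < 1"
  define x y z where "x = enn2real a" and "y = enn2real b" and "z = enn2real c"
  have eq: "a = ennreal x" "b = ennreal y" "c = ennreal z" and nn: "0 \<le> x" "0 \<le> y" "0 \<le> z"
    using fin by (simp_all add: x_def y_def z_def)
  show "enn2real a \<le> l powr (1 - p) * enn2real b + (1 - l) powr (1 - p) * enn2real c"
    using le[OF l] nn unfolding eq by (simp flip: ennreal_mult ennreal_plus)
qed simp_all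


section \<open>Comparing Borel measures on thickened closed sets\<close>

lemma borel_probs_Int_sets:
  assumes "M \<in> borel_probs X" "B \<in> sets borel"
  shows "B \<inter> X \<in> sets M"
  unfolding borel_probs_D(2)[OF assms(1)] sets_restrict_space Int_commute[of B X]
  using assms(2) by (rule imageI)

text \<open>
  The thickenings of a closed set decrease to it, so continuity from above removes
  the thickening.
\<close>

lemma emeasure_le_of_closed_thickenings:
  fixes M N :: "'a::metric_space measure"
  assumes M: "M \<in> borel_probs X" and N: "N \<in> borel_probs X" and C: "closed C"
    and le: "\<And>e. 0 < e \<Longrightarrow> emeasure M (C \<inter> X) \<le> emeasure N ((\<Union>c\<in>C. ball c e) \<inter> X)"
  shows "emeasure M (C \<inter> X) \<le> emeasure N (C \<inter> X)"
proof -
  interpret prob_space N by (rule borel_probs_D(1)[OF N])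
  let ?U = "\<lambda>n::nat. (\<Union>c\<in>C. ball c (1 / real (Suc n))) \<inter> X"
  have "(\<Inter>n. ?U n) = C \<inter> X"
  proof (intro equalityI subsetI)
    fix x assume x: "x \<in> (\<Inter>n. ?U n)"
    have "\<exists>c\<in>C. dist c x < e" if "0 < e" for e
    proof -
      obtain n where n: "1 / real (Suc n) < e"
        using \<open>0 < e\<close> nat_approx_posE by blast
      from x have "x \<in> ?U n" by blast
      then obtain c where "c \<in> C" "dist c x < 1 / real (Suc n)" by auto
      with n show ?thesis by (intro bexI[of _ c]) auto
    qed
    then have "x \<in> C" using closed_approachable[OF C] by blast
    with x show "x \<in> C \<inter> X" by blast
  qed force
  moreover have "(\<lambda>n. emeasure N (?U n)) \<longlonglongrightarrow> emeasure N (\<Inter>n. ?U n)"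
  proof (rule Lim_emeasure_decseq)
    show "range ?U \<subseteq> sets N"
      by (intro image_subsetI borel_probs_Int_sets[OF N] borel_open open_UN) auto
    show "decseq ?U"
    proof (rule antimonoI)
      fix m n :: nat assume "m \<le> n"
      then have "1 / real (Suc n) \<le> 1 / real (Suc m)" by (simp add: field_simps)
      then show "?U n \<subseteq> ?U m" by (fastforce simp: subset_iff)
    qed
  qed simp
  ultimately show ?thesis
    using LIMSEQ_le_const[of "\<lambda>n. emeasure N (?U n)" "emeasure N (C \<inter> X)" "emeasure M (C \<inter> X)"] le
    by auto
qed

text \<open>
  The form in which equality of measures is used twice below: once for measures at
  Wasserstein distance zero, once for measures that agree on balls.  In both cases only a comparison
  up to an arbitrarily small thickening is directly available.
\<close>

lemma borel_probs_eqI_closed: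
  fixes M N :: "'a::metric_space measure"
  assumes X: "X \<in> sets borel" and M: "M \<in> borel_probs X" and N: "N \<in> borel_probs X"
    and MN: "\<And>C e. closed C \<Longrightarrow> 0 < e \<Longrightarrow>
      emeasure M (C \<inter> X) \<le> emeasure N ((\<Union>c\<in>C. ball c e) \<inter> X)"
    and NM: "\<And>C e. closed C \<Longrightarrow> 0 < e \<Longrightarrow>
      emeasure N (C \<inter> X) \<le> emeasure M ((\<Union>c\<in>C. ball c e) \<inter> X)"
  shows "M = N"
proof (rule measure_eqI_generator_eq[where E = "(\<inter>) X ` Collect closed" and A = "\<lambda>_. X" and \<Omega> = X])
  have gen: "sets (restrict_space borel X) = sigma_sets X ((\<inter>) X ` Collect closed)"
    using X sigma_sets_Int[of X UNIV "Collect closed"]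
    by (simp add: sets_restrict_space borel_eq_closed)
  show "sets M = sigma_sets X ((\<inter>) X ` Collect closed)" "sets N = sigma_sets X ((\<inter>) X ` Collect closed)"
    using borel_probs_D(2)[OF M] borel_probs_D(2)[OF N] gen by auto
  show "Int_stable ((\<inter>) X ` Collect closed)"
  proof (rule Int_stableI, clarify)
    fix C D :: "'a set" assume "closed C" "closed D"
    then show "X \<inter> C \<inter> (X \<inter> D) \<in> (\<inter>) X ` Collect closed"
      by (intro image_eqI[of _ _ "C \<inter> D"]) auto
  qed
  fix Y assume "Y \<in> (\<inter>) X ` Collect closed"
  then obtain C where C: "closed C" "Y = C \<inter> X" by auto
  show "emeasure M Y = emeasure N Y"
    unfolding C(2)
    by (intro antisym emeasure_le_of_closed_thickenings[OF M N C(1)]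
        emeasure_le_of_closed_thickenings[OF N M C(1)] MN NM C(1))
next
  show "range (\<lambda>_. X) \<subseteq> (\<inter>) X ` Collect closed"
    by (auto intro: image_eqI[of _ _ UNIV])
  interpret prob_space M by (rule borel_probs_D(1)[OF M])
  show "emeasure M X \<noteq> \<infinity>"
    by simp
qed auto


section \<open>Couplings and gluing\<close>

lemma measurable_restrict_borel_D:
  assumes "sets \<alpha> = sets (restrict_space borel X)" "f \<in> M \<rightarrow>\<^sub>M \<alpha>"
  shows "f \<in> borel_measurable M"
  using assms(2) measurable_cong_sets[OF refl assms(1), of M]
  by (auto simp: measurable_restrict_space2_iff)

lemma couplings_D:
  assumes "\<gamma> \<in> couplings \<alpha> \<beta>"
  shows "prob_space \<gamma>" "sets \<gamma> = sets (\<alpha> \<Otimes>\<^sub>M \<beta>)" "space \<gamma> = space \<alpha> \<times> space \<beta>"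
    "distr \<gamma> \<alpha> fst = \<alpha>" "distr \<gamma> \<beta> snd = \<beta>"
    "fst \<in> \<gamma> \<rightarrow>\<^sub>M \<alpha>" "snd \<in> \<gamma> \<rightarrow>\<^sub>M \<beta>"
proof -
  show *: "prob_space \<gamma>" "sets \<gamma> = sets (\<alpha> \<Otimes>\<^sub>M \<beta>)" "distr \<gamma> \<alpha> fst = \<alpha>" "distr \<gamma> \<beta> snd = \<beta>"
    using assms by (auto simp: couplings_def)
  show "space \<gamma> = space \<alpha> \<times> space \<beta>"
    using sets_eq_imp_space_eq[OF *(2)] by (simp add: space_pair_measure)
  show "fst \<in> \<gamma> \<rightarrow>\<^sub>M \<alpha>" "snd \<in> \<gamma> \<rightarrow>\<^sub>M \<beta>"
    by (simp_all cong: measurable_cong_sets add: *(2))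
qed

lemma distr_Pair_in_couplings:
  assumes "prob_space M" and f: "f \<in> M \<rightarrow>\<^sub>M \<alpha>" and g: "g \<in> M \<rightarrow>\<^sub>M \<beta>"
    and "distr M \<alpha> f = \<alpha>" "distr M \<beta> g = \<beta>"
  shows "distr M (\<alpha> \<Otimes>\<^sub>M \<beta>) (\<lambda>x. (f x, g x)) \<in> couplings \<alpha> \<beta>"
  using assms prob_space.prob_space_distr[OF assms(1) measurable_Pair[OF f g]]
  by (simp add: couplings_def distr_distr comp_def)

text \<open>
  The labels of mass zero are countably many, so together they are negligible.
\<close>

lemma AE_label_not_null:
  fixes k :: "'a \<Rightarrow> 'b::countable"
  assumes k [measurable]: "k \<in> M \<rightarrow>\<^sub>M count_space UNIV"
  shows "AE u in M. emeasure M (k -` {k u} \<inter> space M) \<noteq> 0"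
proof -
  have "AE u in M. emeasure M (k -` {j} \<inter> space M) = 0 \<longrightarrow> k u \<noteq> j" for j
  proof (cases "emeasure M (k -` {j} \<inter> space M) = 0")
    case True
    then have "AE u in M. u \<notin> k -` {j} \<inter> space M"
      by (intro AE_not_in) (simp add: null_sets_def)
    then show ?thesis by (rule AE_mp) (auto intro!: AE_I2)
  qed simp
  then have "AE u in M. \<forall>j. emeasure M (k -` {j} \<inter> space M) = 0 \<longrightarrow> k u \<noteq> j"
    by (simp add: AE_all_countable)
  then show ?thesis by (rule AE_mp) (auto intro!: AE_I2)
qed

text \<open>
  A discrete gluing lemma.  If the labels \<open>k\<close> and \<open>l\<close> have the same distribution, then
  the two measures can be joined conditionally independently given the label.  As the labels are
  countable, the joint measure has an explicit density with respect to the product measure.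
\<close>

lemma coupling_with_equal_labels:
  fixes M :: "'a measure" and N :: "'b measure" and k :: "'a \<Rightarrow> int" and l :: "'b \<Rightarrow> int"
  assumes "prob_space M" "prob_space N"
    and k [measurable]: "k \<in> M \<rightarrow>\<^sub>M count_space UNIV" and l [measurable]: "l \<in> N \<rightarrow>\<^sub>M count_space UNIV"
    and law: "\<And>j. emeasure M (k -` {j} \<inter> space M) = emeasure N (l -` {j} \<inter> space N)"
  shows "\<exists>\<gamma>\<in>couplings M N. AE z in \<gamma>. k (fst z) = l (snd z)"
proof -
  interpret M: prob_space M by fact
  interpret N: prob_space N by fact
  interpret MN: pair_prob_space M N ..
  \<comment> \<open>Each diagonal cell \<open>{k = j} \<times> {l = j}\<close> has product mass \<open>m j * m j\<close> and must receive mass \<open>m j\<close>.\<close>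
  define m where "m j = emeasure N (l -` {j} \<inter> space N)" for j
  define h where "h z = (if k (fst z) = l (snd z) then inverse (m (k (fst z))) else 0)" for z
  have h [measurable]: "h \<in> borel_measurable (M \<Otimes>\<^sub>M N)"
    unfolding h_def by measurable
  define \<gamma> where "\<gamma> = density (M \<Otimes>\<^sub>M N) h"
  have m_fin: "m j \<noteq> \<infinity>" for j by (simp add: m_def)
  have pos_k: "AE u in M. m (k u) \<noteq> 0" and pos_l: "AE v in N. m (l v) \<noteq> 0"
    using AE_label_not_null[OF k] AE_label_not_null[OF l] by (simp_all add: m_def law)
  \<comment> \<open>The density integrates to 1 along almost every fibre, which is what fixes the two marginals.\<close>
  have int_v: "AE u in M. (\<integral>\<^sup>+ v. h (u, v) \<partial>N) = 1"
    using pos_k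
  proof (rule AE_mp, intro AE_I2 impI)
    fix u assume u: "m (k u) \<noteq> 0"
    have "(\<integral>\<^sup>+ v. h (u, v) \<partial>N) = (\<integral>\<^sup>+ v. inverse (m (k u)) * indicator (l -` {k u} \<inter> space N) v \<partial>N)"
      by (intro nn_integral_cong) (auto simp: h_def split: split_indicator)
    also have "\<dots> = inverse (m (k u)) * m (k u)"
      by (subst nn_integral_cmult_indicator) (simp_all add: m_def)
    also have "\<dots> = 1"
      using u m_fin ennreal_divide_self[of "m (k u)"]
      by (simp add: divide_ennreal_def mult.commute less_top)
    finally show "(\<integral>\<^sup>+ v. h (u, v) \<partial>N) = 1" .
  qed
  have int_u: "AE v in N. (\<integral>\<^sup>+ u. h (u, v) \<partial>M) = 1"
    using pos_l
  proof (rule AE_mp, intro AE_I2 impI)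
    fix v assume v: "m (l v) \<noteq> 0"
    have "(\<integral>\<^sup>+ u. h (u, v) \<partial>M) = (\<integral>\<^sup>+ u. inverse (m (l v)) * indicator (k -` {l v} \<inter> space M) u \<partial>M)"
      by (intro nn_integral_cong) (auto simp: h_def split: split_indicator)
    also have "\<dots> = inverse (m (l v)) * m (l v)"
      by (subst nn_integral_cmult_indicator) (simp_all add: m_def law)
    also have "\<dots> = 1"
      using v m_fin ennreal_divide_self[of "m (l v)"]
      by (simp add: divide_ennreal_def mult.commute less_top)
    finally show "(\<integral>\<^sup>+ u. h (u, v) \<partial>M) = 1" .
  qed
  have fst: "emeasure \<gamma> (fst -` B \<inter> space \<gamma>) = emeasure M B" if B [measurable]: "B \<in> sets M" for B
  proof -
    have "emeasure \<gamma> (fst -` B \<inter> space \<gamma>)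
        = (\<integral>\<^sup>+ z. h z * indicator (fst -` B \<inter> space (M \<Otimes>\<^sub>M N)) z \<partial>(M \<Otimes>\<^sub>M N))"
      by (simp add: \<gamma>_def emeasure_density)
    also have "\<dots> = (\<integral>\<^sup>+ z. h z * indicator B (fst z) \<partial>(M \<Otimes>\<^sub>M N))"
      by (intro nn_integral_cong) (auto split: split_indicator)
    also have "\<dots> = (\<integral>\<^sup>+ u. \<integral>\<^sup>+ v. h (u, v) * indicator B u \<partial>N \<partial>M)"
      by (subst N.nn_integral_fst[symmetric]) simp_all
    also have "\<dots> = (\<integral>\<^sup>+ u. indicator B u \<partial>M)"
      using int_v by (intro nn_integral_cong_AE) (auto simp: nn_integral_multc)
    finally show ?thesis by simp
  qed
  have snd: "emeasure \<gamma> (snd -` B \<inter> space \<gamma>) = emeasure N B" if B [measurable]: "B \<in> sets N" for B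
  proof -
    have "emeasure \<gamma> (snd -` B \<inter> space \<gamma>)
        = (\<integral>\<^sup>+ z. h z * indicator (snd -` B \<inter> space (M \<Otimes>\<^sub>M N)) z \<partial>(M \<Otimes>\<^sub>M N))"
      by (simp add: \<gamma>_def emeasure_density)
    also have "\<dots> = (\<integral>\<^sup>+ z. h z * indicator B (snd z) \<partial>(M \<Otimes>\<^sub>M N))"
      by (intro nn_integral_cong) (auto split: split_indicator)
    also have "\<dots> = (\<integral>\<^sup>+ v. \<integral>\<^sup>+ u. h (u, v) * indicator B v \<partial>M \<partial>N)"
      by (subst MN.nn_integral_snd[symmetric]) simp_all
    also have "\<dots> = (\<integral>\<^sup>+ v. indicator B v \<partial>N)"
      using int_u by (intro nn_integral_cong_AE) (auto simp: nn_integral_multc)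
    finally show ?thesis by simp
  qed
  have "fst -` space M \<inter> space \<gamma> = space \<gamma>"
    by (auto simp: \<gamma>_def space_pair_measure)
  then have "prob_space \<gamma>"
    using fst[OF sets.top] by (intro prob_spaceI) (simp add: M.emeasure_space_1)
  moreover have "distr \<gamma> M fst = M"
    using fst by (intro measure_eqI) (simp_all add: emeasure_distr \<gamma>_def)
  moreover have "distr \<gamma> N snd = N"
    using snd by (intro measure_eqI) (simp_all add: emeasure_distr \<gamma>_def)
  moreover have "AE z in \<gamma>. k (fst z) = l (snd z)"
    unfolding \<gamma>_def AE_density[OF h] by (auto simp: h_def)
  ultimately show ?thesis
    by (intro bexI[of _ \<gamma>]) (auto simp: couplings_def \<gamma>_def)
qed


section \<open>The Wasserstein distance on the interval\<close>

lemma measurable_cost: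
  assumes "sets \<alpha> = sets (restrict_space borel X)" "sets \<beta> = sets (restrict_space borel Y)"
  shows "(\<lambda>(x, y). ennreal (\<bar>x - y :: real\<bar> powr p)) \<in> borel_measurable (\<alpha> \<Otimes>\<^sub>M \<beta>)"
proof -
  note [measurable] = measurable_restrict_borel_D[OF assms(1) measurable_fst]
    measurable_restrict_borel_D[OF assms(2) measurable_snd]
  show ?thesis
    unfolding split_beta' by measurable
qed

text \<open>
  Two random variables on a common probability space form a coupling of their laws, so
  bounding the Wasserstein cost amounts to choosing such a pair.
\<close>

lemma wasserstein_pow_le_distr_Pair:
  assumes "prob_space M" and f: "f \<in> M \<rightarrow>\<^sub>M \<alpha>" and g: "g \<in> M \<rightarrow>\<^sub>M \<beta>"
    and d: "distr M \<alpha> f = \<alpha>" "distr M \<beta> g = \<beta>"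
    and ab: "sets \<alpha> = sets (restrict_space borel X)" "sets \<beta> = sets (restrict_space borel Y)"
  shows "wasserstein_pow p \<alpha> \<beta> \<le> (\<integral>\<^sup>+ x. ennreal (\<bar>f x - g x\<bar> powr p) \<partial>M)"
proof -
  have "wasserstein_pow p \<alpha> \<beta>
      \<le> (\<integral>\<^sup>+ (x, y). ennreal (\<bar>x - y\<bar> powr p) \<partial>distr M (\<alpha> \<Otimes>\<^sub>M \<beta>) (\<lambda>x. (f x, g x)))"
    unfolding wasserstein_pow_def
    by (intro INF_lower distr_Pair_in_couplings assms)
  also have "\<dots> = (\<integral>\<^sup>+ x. ennreal (\<bar>f x - g x\<bar> powr p) \<partial>M)"
    by (subst nn_integral_distr[OF measurable_Pair[OF f g]]) (simp_all add: measurable_cost[OF ab])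
  finally show ?thesis .
qed

text \<open>
  Symmetry of a metric in the sense of
  \<^locale>\<open>Metric_space\<close> concerns all measures on the type, and slices of arbitrary measures have these sigma-algebras.
\<close>

lemma wasserstein_pow_commute_le:
  assumes "sets \<alpha> = sets (restrict_space borel X)" "sets \<beta> = sets (restrict_space borel Y)"
  shows "wasserstein_pow p \<alpha> \<beta> \<le> wasserstein_pow p \<beta> \<alpha>"
  unfolding wasserstein_pow_def[of p \<beta> \<alpha>]
proof (rule INF_greatest)
  fix \<gamma> assume \<gamma>: "\<gamma> \<in> couplings \<beta> \<alpha>"
  note C = couplings_D[OF \<gamma>]
  have "wasserstein_pow p \<alpha> \<beta> \<le> (\<integral>\<^sup>+ z. ennreal (\<bar>snd z - fst z\<bar> powr p) \<partial>\<gamma>)"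
    by (intro wasserstein_pow_le_distr_Pair[OF _ _ _ _ _ assms] C)
  then show "wasserstein_pow p \<alpha> \<beta> \<le> (\<integral>\<^sup>+ (x, y). ennreal (\<bar>x - y\<bar> powr p) \<partial>\<gamma>)"
    by (simp add: split_beta' abs_minus_commute)
qed

lemma wasserstein_pow_commute:
  assumes "sets \<alpha> = sets (restrict_space borel X)" "sets \<beta> = sets (restrict_space borel Y)"
  shows "wasserstein_pow p \<alpha> \<beta> = wasserstein_pow p \<beta> \<alpha>"
  by (intro antisym wasserstein_pow_commute_le[OF assms] wasserstein_pow_commute_le[OF assms(2,1)])

lemma wasserstein_pow_self:
  assumes "\<alpha> \<in> borel_probs X" "0 < p"
  shows "wasserstein_pow p \<alpha> \<alpha> = 0"
proof -
  have "wasserstein_pow p \<alpha> \<alpha> \<le> (\<integral>\<^sup>+ x. ennreal (\<bar>x - x\<bar> powr p) \<partial>\<alpha>)"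
    by (intro wasserstein_pow_le_distr_Pair[where X = X and Y = X]
        borel_probs_D[OF assms(1)] measurable_ident_sets distr_id2 refl)
  then show ?thesis
    using assms(2) by simp
qed

text \<open>
  The triangle inequality of \<open>W_p\<close> in its weighted form.  The intermediate measure \<open>\<beta>\<close> is cut into
  cells of length \<open>t\<close>, and nearly optimal couplings of \<open>(\<alpha>, \<beta>)\<close> and of \<open>(\<beta>, \<delta>)\<close> are glued along the
  cell of the middle coordinate.  The two middle coordinates then differ by less than \<open>t\<close>, which
  changes the cost by less than \<open>\<epsilon>\<close> because the cost is uniformly continuous on the compact
  square.
\<close>

lemma wasserstein_pow_triangle:
  fixes l p :: real
  assumes p: "1 \<le> p" and l: "0 < l" "l < 1"
    and \<alpha>: "\<alpha> \<in> borel_probs {0..pi}" and \<beta>: "\<beta> \<in> borel_probs {0..pi}" and \<delta>: "\<delta> \<in> borel_probs {0..pi}"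
  shows "wasserstein_pow p \<alpha> \<delta> \<le> ennreal (l powr (1 - p)) * wasserstein_pow p \<alpha> \<beta>
    + ennreal ((1 - l) powr (1 - p)) * wasserstein_pow p \<beta> \<delta>"
proof (rule ennreal_le_epsilon)
  define c d where "c = l powr (1 - p)" and "d = (1 - l) powr (1 - p)"
  have cd: "0 < c" "0 < d" using l by (auto simp: c_def d_def)
  let ?W = "wasserstein_pow p"
  let ?cost = "\<lambda>x y :: real. \<bar>x - y\<bar> powr p"
  fix e :: real assume "0 < e"
  \<comment> \<open>The choice makes the total error \<open>c * \<epsilon> + 2 * d * \<epsilon>\<close> equal to \<open>e\<close>.\<close>
  define \<epsilon> where "\<epsilon> = e / (c + 2 * d)"
  have \<epsilon>: "0 < \<epsilon>" using cd \<open>0 < e\<close> by (auto simp: \<epsilon>_def intro!: divide_pos_pos)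
  have fin: "?W \<alpha> \<beta> \<noteq> \<infinity>" "?W \<beta> \<delta> \<noteq> \<infinity>"
    using wasserstein_pow_le[OF _ \<alpha> \<beta>, of p] wasserstein_pow_le[OF _ \<beta> \<delta>, of p] p
    by (auto simp: top_unique)
  obtain \<gamma>1 where \<gamma>1: "\<gamma>1 \<in> couplings \<alpha> \<beta>"
    and I1: "(\<integral>\<^sup>+ (x, y). ennreal (?cost x y) \<partial>\<gamma>1) < ?W \<alpha> \<beta> + ennreal \<epsilon>"
    using INF_approx_ennreal[OF \<epsilon> wasserstein_pow_def fin(1)] by blast
  obtain \<gamma>2 where \<gamma>2: "\<gamma>2 \<in> couplings \<beta> \<delta>"
    and I2: "(\<integral>\<^sup>+ (x, y). ennreal (?cost x y) \<partial>\<gamma>2) < ?W \<beta> \<delta> + ennreal \<epsilon>"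
    using INF_approx_ennreal[OF \<epsilon> wasserstein_pow_def fin(2)] by blast
  note C1 = couplings_D[OF \<gamma>1] and C2 = couplings_D[OF \<gamma>2]
  have "uniformly_continuous_on ({0..pi} \<times> {0..pi}) (\<lambda>z. ?cost (fst z) (snd z))"
    using p by (intro compact_uniformly_continuous compact_Times continuous_on_powr' continuous_intros) auto
  then obtain t where t: "0 < t"
    and unif: "\<And>z z'. z \<in> {0..pi} \<times> {0..pi} \<Longrightarrow> z' \<in> {0..pi} \<times> {0..pi} \<Longrightarrow> dist z' z < t \<Longrightarrow>
      dist (?cost (fst z') (snd z')) (?cost (fst z) (snd z)) < \<epsilon>"
    unfolding uniformly_continuous_on_def using \<epsilon> by metis
  \<comment> \<open>Points with the same label \<open>q\<close> are less than \<open>t\<close> apart.\<close>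
  define q where "q y = \<lfloor>y / t\<rfloor>" for y
  have q: "q \<in> borel \<rightarrow>\<^sub>M count_space UNIV"
    unfolding q_def by measurable
  have q\<beta>: "q \<in> \<beta> \<rightarrow>\<^sub>M count_space UNIV"
    using measurable_compose[OF measurable_restrict_borel_D[OF borel_probs_D(2)[OF \<beta>] measurable_ident] q]
    by (simp add: id_def)
  note qm = measurable_compose[OF C1(7) q\<beta>] measurable_compose[OF C2(6) q\<beta>]
  \<comment> \<open>Both sides equal the \<open>\<beta>\<close>-mass of the cell \<open>{q = j}\<close>.\<close>
  have law: "emeasure \<gamma>1 ((\<lambda>u. q (snd u)) -` {j} \<inter> space \<gamma>1)
      = emeasure \<gamma>2 ((\<lambda>v. q (fst v)) -` {j} \<inter> space \<gamma>2)" for j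
  proof -
    let ?B = "q -` {j} \<inter> space \<beta>"
    have B: "?B \<in> sets \<beta>" using measurable_sets[OF q\<beta>] by simp
    have "(\<lambda>u. q (snd u)) -` {j} \<inter> space \<gamma>1 = snd -` ?B \<inter> space \<gamma>1"
      "(\<lambda>v. q (fst v)) -` {j} \<inter> space \<gamma>2 = fst -` ?B \<inter> space \<gamma>2"
      by (auto simp: C1(3) C2(3))
    then show ?thesis
      using emeasure_distr[OF C1(7) B] emeasure_distr[OF C2(6) B] by (simp add: C1(5) C2(4))
  qed
  obtain \<gamma> where \<gamma>: "\<gamma> \<in> couplings \<gamma>1 \<gamma>2" and near: "AE z in \<gamma>. q (snd (fst z)) = q (fst (snd z))"
    using coupling_with_equal_labels[OF C1(1) C2(1) qm law] by auto
  note C = couplings_D[OF \<gamma>]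
  note m1 = measurable_compose[OF C(6) C1(6)] and m2 = measurable_compose[OF C(7) C2(7)]
  have marg: "distr \<gamma> \<alpha> (\<lambda>z. fst (fst z)) = \<alpha>" "distr \<gamma> \<delta> (\<lambda>z. snd (snd z)) = \<delta>"
    using distr_distr[OF C1(6) C(6)] distr_distr[OF C2(7) C(7)]
    unfolding C(4,5) C1(4) C2(5) by (simp_all add: comp_def)
  have cm1: "(\<lambda>u. ennreal (?cost (fst u) (snd u))) \<in> borel_measurable \<gamma>1"
    using measurable_cost[OF borel_probs_D(2)[OF \<alpha>] borel_probs_D(2)[OF \<beta>], of p] by (simp add: split_beta' cong: measurable_cong_sets[OF C1(2)])
  have cm2: "(\<lambda>u. ennreal (?cost (fst u) (snd u))) \<in> borel_measurable \<gamma>2"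
    using measurable_cost[OF borel_probs_D(2)[OF \<beta>] borel_probs_D(2)[OF \<delta>], of p] by (simp add: split_beta' cong: measurable_cong_sets[OF C2(2)])
  have "?W \<alpha> \<delta> \<le> (\<integral>\<^sup>+ z. ennreal (?cost (fst (fst z)) (snd (snd z))) \<partial>\<gamma>)"
    by (intro wasserstein_pow_le_distr_Pair[OF _ _ _ _ _ borel_probs_D(2)[OF \<alpha>] borel_probs_D(2)[OF \<delta>]] C(1) m1 m2 marg)
  also have "\<dots> \<le> (\<integral>\<^sup>+ z. ennreal c * ennreal (?cost (fst (fst z)) (snd (fst z)))
      + (ennreal d * ennreal (?cost (fst (snd z)) (snd (snd z))) + ennreal (d * \<epsilon>)) \<partial>\<gamma>)"
  proof (rule nn_integral_mono_AE)
    have pointwise: "ennreal (?cost (fst (fst z)) (snd (snd z)))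
        \<le> ennreal c * ennreal (?cost (fst (fst z)) (snd (fst z)))
          + (ennreal d * ennreal (?cost (fst (snd z)) (snd (snd z))) + ennreal (d * \<epsilon>))"
      if z: "z \<in> space \<gamma>" and eq: "q (snd (fst z)) = q (fst (snd z))" for z
    proof -
      obtain x y y' w where zz: "z = ((x, y), (y', w))" by (metis prod.exhaust)
      have rng: "x \<in> {0..pi}" "y \<in> {0..pi}" "y' \<in> {0..pi}" "w \<in> {0..pi}"
        using z by (auto simp: zz C(3) C1(3) C2(3) borel_probs_D(3)[OF \<alpha>]
            borel_probs_D(3)[OF \<beta>] borel_probs_D(3)[OF \<delta>])
      have "\<bar>y / t - y' / t\<bar> < 1"
        using eq unfolding zz q_def fst_conv snd_conv by linarith
      then have "\<bar>y - y'\<bar> < t"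
        using t by (simp add: field_simps abs_less_iff)
      then have "?cost y w \<le> ?cost y' w + \<epsilon>"
        using unif[of "(y', w)" "(y, w)"] rng by (auto simp: dist_Pair_Pair dist_real_def)
      then have "d * ?cost y w \<le> d * ?cost y' w + d * \<epsilon>"
        using cd by (simp flip: distrib_left)
      moreover have "?cost x w \<le> c * ?cost x y + d * ?cost y w"
      proof -
        have "?cost x w \<le> (\<bar>x - y\<bar> + \<bar>y - w\<bar>) powr p"
          using p by (intro powr_mono2) auto
        also have "\<dots> \<le> c * ?cost x y + d * ?cost y w"
          unfolding c_def d_def by (intro powr_add_le p l) auto
        finally show ?thesis .
      qed
      ultimately have "?cost x w \<le> c * ?cost x y + (d * ?cost y' w + d * \<epsilon>)" by linarith
      then show ?thesis
        using cd \<epsilon> by (simp add: zz ennreal_leI flip: ennreal_mult ennreal_plus)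
    qed
    show "AE z in \<gamma>. ennreal (?cost (fst (fst z)) (snd (snd z)))
        \<le> ennreal c * ennreal (?cost (fst (fst z)) (snd (fst z)))
          + (ennreal d * ennreal (?cost (fst (snd z)) (snd (snd z))) + ennreal (d * \<epsilon>))"
      using near by (rule AE_mp) (intro AE_I2 impI pointwise)
  qed
  also have "\<dots> = ennreal c * (\<integral>\<^sup>+ z. ennreal (?cost (fst (fst z)) (snd (fst z))) \<partial>\<gamma>)
      + (ennreal d * (\<integral>\<^sup>+ z. ennreal (?cost (fst (snd z)) (snd (snd z))) \<partial>\<gamma>) + ennreal (d * \<epsilon>))"
    using measurable_compose[OF C(6) cm1] measurable_compose[OF C(7) cm2]
    by (simp add: nn_integral_add nn_integral_cmult prob_space.emeasure_space_1[OF C(1)])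
  also have "(\<integral>\<^sup>+ z. ennreal (?cost (fst (fst z)) (snd (fst z))) \<partial>\<gamma>)
      = (\<integral>\<^sup>+ (x, y). ennreal (?cost x y) \<partial>\<gamma>1)"
    using nn_integral_distr[OF C(6), of "\<lambda>u. ennreal (?cost (fst u) (snd u))"] cm1
    by (simp add: C(4) split_beta')
  also have "(\<integral>\<^sup>+ z. ennreal (?cost (fst (snd z)) (snd (snd z))) \<partial>\<gamma>)
      = (\<integral>\<^sup>+ (x, y). ennreal (?cost x y) \<partial>\<gamma>2)"
    using nn_integral_distr[OF C(7), of "\<lambda>u. ennreal (?cost (fst u) (snd u))"] cm2
    by (simp add: C(5) split_beta')
  also have "ennreal c * (\<integral>\<^sup>+ (x, y). ennreal (?cost x y) \<partial>\<gamma>1)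
      + (ennreal d * (\<integral>\<^sup>+ (x, y). ennreal (?cost x y) \<partial>\<gamma>2) + ennreal (d * \<epsilon>))
      \<le> ennreal c * (?W \<alpha> \<beta> + ennreal \<epsilon>) + (ennreal d * (?W \<beta> \<delta> + ennreal \<epsilon>) + ennreal (d * \<epsilon>))"
    using I1 I2 by (intro add_mono mult_left_mono) auto
  also have "\<dots> = ennreal c * ?W \<alpha> \<beta> + ennreal d * ?W \<beta> \<delta>
      + (ennreal c * ennreal \<epsilon> + (ennreal d * ennreal \<epsilon> + ennreal (d * \<epsilon>)))"
    by (simp only: distrib_left ac_simps)
  also have "ennreal c * ennreal \<epsilon> + (ennreal d * ennreal \<epsilon> + ennreal (d * \<epsilon>))
      = ennreal (c * \<epsilon> + d * \<epsilon> + d * \<epsilon>)"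
    using cd \<epsilon> by (simp add: add.assoc flip: ennreal_mult ennreal_plus)
  also have "c * \<epsilon> + d * \<epsilon> + d * \<epsilon> = (c + 2 * d) * \<epsilon>"
    by (simp add: algebra_simps)
  also have "\<dots> = e"
    using cd by (simp add: \<epsilon>_def)
  finally show "?W \<alpha> \<delta> \<le> ennreal (l powr (1 - p)) * ?W \<alpha> \<beta>
      + ennreal ((1 - l) powr (1 - p)) * ?W \<beta> \<delta> + ennreal e"
    by (simp add: c_def d_def)
qed

text \<open>
  A Markov-type estimate: mass of a coupling that starts in \<open>C\<close> and ends outside the
  thickening pays at least \<open>e powr p\<close> per unit.
\<close>

lemma emeasure_le_thickening_add_cost:
  fixes e p :: real
  assumes p: "0 < p" and \<alpha>: "\<alpha> \<in> borel_probs X" and \<beta>: "\<beta> \<in> borel_probs X"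
    and \<gamma>: "\<gamma> \<in> couplings \<alpha> \<beta>" and C: "closed C" and e: "0 < e"
  shows "emeasure \<alpha> (C \<inter> X) \<le> emeasure \<beta> ((\<Union>c\<in>C. ball c e) \<inter> X)
    + ennreal (1 / e powr p) * (\<integral>\<^sup>+ (x, y). ennreal (\<bar>x - y\<bar> powr p) \<partial>\<gamma>)"
proof -
  let ?U = "\<Union>c\<in>C. ball c e"
  note D = couplings_D[OF \<gamma>]
  have cost: "(\<lambda>z. ennreal (\<bar>fst z - snd z\<bar> powr p)) \<in> borel_measurable \<gamma>"
    using measurable_cost[OF borel_probs_D(2)[OF \<alpha>] borel_probs_D(2)[OF \<beta>], of p]
    by (simp add: split_beta' cong: measurable_cong_sets[OF D(2)])
  have CX: "C \<inter> X \<in> sets \<alpha>"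
    using C by (intro borel_probs_Int_sets[OF \<alpha>]) simp
  have UX: "?U \<inter> X \<in> sets \<beta>"
    by (intro borel_probs_Int_sets[OF \<beta>] borel_open open_UN) auto
  have UX': "snd -` (?U \<inter> X) \<inter> space \<gamma> \<in> sets \<gamma>"
    by (rule measurable_sets[OF D(7) UX])
  have "emeasure \<alpha> (C \<inter> X) = (\<integral>\<^sup>+ z. indicator (fst -` (C \<inter> X) \<inter> space \<gamma>) z \<partial>\<gamma>)"
    using emeasure_distr[OF D(6) CX] measurable_sets[OF D(6) CX] by (simp add: D(4))
  also have "\<dots> \<le> (\<integral>\<^sup>+ z. indicator (snd -` (?U \<inter> X) \<inter> space \<gamma>) z
      + ennreal (1 / e powr p) * ennreal (\<bar>fst z - snd z\<bar> powr p) \<partial>\<gamma>)"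
  proof (rule nn_integral_mono)
    fix z assume z: "z \<in> space \<gamma>"
    obtain x y where xy: "z = (x, y)" by (cases z)
    with z have "x \<in> X" "y \<in> X"
      by (auto simp: D(3) borel_probs_D(3)[OF \<alpha>] borel_probs_D(3)[OF \<beta>])
    show "indicator (fst -` (C \<inter> X) \<inter> space \<gamma>) z \<le> indicator (snd -` (?U \<inter> X) \<inter> space \<gamma>) z
        + ennreal (1 / e powr p) * ennreal (\<bar>fst z - snd z\<bar> powr p)"
    \<comment> \<open>If mass leaves \<open>C\<close> without arriving in the thickening, then it travels at least \<open>e\<close>.\<close>
    proof (cases "x \<in> C \<and> y \<notin> ?U")
      case True
      then have "e \<le> \<bar>x - y\<bar>"
        by (auto simp: dist_real_def not_less)
      then have "e powr p \<le> \<bar>x - y\<bar> powr p"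
        using e p by (intro powr_mono2) auto
      then have "1 \<le> 1 / e powr p * \<bar>x - y\<bar> powr p"
        using e by (simp add: field_simps)
      then have "1 \<le> ennreal (1 / e powr p) * ennreal (\<bar>x - y\<bar> powr p)"
        by (simp flip: ennreal_mult ennreal_1)
      then show ?thesis
        using True by (auto simp: xy split: split_indicator)
    next
      case False
      then have "indicator (fst -` (C \<inter> X) \<inter> space \<gamma>) z
          \<le> (indicator (snd -` (?U \<inter> X) \<inter> space \<gamma>) z :: ennreal)"
        using z \<open>y \<in> X\<close> by (simp add: xy split: split_indicator)
      then show ?thesis by (rule order_trans) simp
    qed
  qed
  also have "\<dots> = emeasure \<beta> (?U \<inter> X)
      + ennreal (1 / e powr p) * (\<integral>\<^sup>+ (x, y). ennreal (\<bar>x - y\<bar> powr p) \<partial>\<gamma>)"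
    using cost UX' emeasure_distr[OF D(7) UX]
    by (simp add: nn_integral_add nn_integral_cmult D(5) split_beta' del: vimage_Int)
  finally show ?thesis .
qed

text \<open>
  Couplings of arbitrarily small cost move arbitrarily little mass further than \<open>e\<close>, so each
  measure is dominated by the other on thickenings of closed sets.
\<close>

lemma wasserstein_pow_eq_0D:
  assumes p: "0 < p" and \<alpha>: "\<alpha> \<in> borel_probs X" and \<beta>: "\<beta> \<in> borel_probs X" and X: "X \<in> sets borel"
    and zero: "wasserstein_pow p \<alpha> \<beta> = 0"
  shows "\<alpha> = \<beta>"
proof -
  have le: "emeasure \<alpha> (C \<inter> X) \<le> emeasure \<beta> ((\<Union>c\<in>C. ball c e) \<inter> X)"
    if \<alpha>: "\<alpha> \<in> borel_probs X" and \<beta>: "\<beta> \<in> borel_probs X" and zero: "wasserstein_pow p \<alpha> \<beta> = 0"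
      and C: "closed C" and e: "0 < e" for \<alpha> \<beta> C and e :: real
  proof (rule ennreal_le_epsilon)
    fix \<eta> :: real assume "0 < \<eta>"
    then have "0 < \<eta> * e powr p" using e by simp
    then obtain \<gamma> where \<gamma>: "\<gamma> \<in> couplings \<alpha> \<beta>"
      and I: "(\<integral>\<^sup>+ (x, y). ennreal (\<bar>x - y\<bar> powr p) \<partial>\<gamma>) < ennreal (\<eta> * e powr p)"
      using INF_approx_ennreal[OF _ wasserstein_pow_def[of p \<alpha> \<beta>]] zero by auto
    note emeasure_le_thickening_add_cost[OF p \<alpha> \<beta> \<gamma> C e]
    also have "ennreal (1 / e powr p) * (\<integral>\<^sup>+ (x, y). ennreal (\<bar>x - y\<bar> powr p) \<partial>\<gamma>)
        \<le> ennreal (1 / e powr p) * ennreal (\<eta> * e powr p)"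
      using I by (intro mult_left_mono) auto
    also have "ennreal (1 / e powr p) * ennreal (\<eta> * e powr p) = ennreal \<eta>"
      using e \<open>0 < \<eta>\<close> by (simp flip: ennreal_mult)
    finally show "emeasure \<alpha> (C \<inter> X) \<le> emeasure \<beta> ((\<Union>c\<in>C. ball c e) \<inter> X) + ennreal \<eta>"
      by (simp add: add_left_mono)
  qed
  have "wasserstein_pow p \<beta> \<alpha> = 0"
    using zero wasserstein_pow_commute[OF borel_probs_D(2)[OF \<alpha>] borel_probs_D(2)[OF \<beta>]] by simp
  with assms show ?thesis
    by (intro borel_probs_eqI_closed[OF X \<alpha> \<beta>] le) auto
qed

definition wasserstein :: "real \<Rightarrow> real measure \<Rightarrow> real measure \<Rightarrow> real" where
  "wasserstein p \<alpha> \<beta> = enn2real (wasserstein_pow p \<alpha> \<beta>) powr (1 / p)"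

lemma wasserstein_pow_eq:
  assumes "0 < p" "\<alpha> \<in> borel_probs {0..pi}" "\<beta> \<in> borel_probs {0..pi}"
  shows "wasserstein_pow p \<alpha> \<beta> = ennreal (wasserstein p \<alpha> \<beta> powr p)"
proof -
  have "wasserstein_pow p \<alpha> \<beta> < \<infinity>"
    using wasserstein_pow_le[of p \<alpha> \<beta>] assms by (auto intro: le_less_trans)
  then show ?thesis
    using assms(1) by (simp add: wasserstein_def powr_powr)
qed

lemma wasserstein_triangle:
  assumes "1 \<le> p" "\<alpha> \<in> borel_probs {0..pi}" "\<beta> \<in> borel_probs {0..pi}" "\<delta> \<in> borel_probs {0..pi}"
  shows "wasserstein p \<alpha> \<delta> \<le> wasserstein p \<alpha> \<beta> + wasserstein p \<beta> \<delta>"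
proof -
  have fin: "wasserstein_pow p \<alpha>' \<beta>' < \<infinity>"
    if "\<alpha>' \<in> borel_probs {0..pi}" "\<beta>' \<in> borel_probs {0..pi}" for \<alpha>' \<beta>'
    using wasserstein_pow_le[of p \<alpha>' \<beta>'] that assms(1) by (auto intro: le_less_trans)
  show ?thesis
    unfolding wasserstein_def
    by (intro enn2real_powr_triangleI wasserstein_pow_triangle fin assms)
qed


section \<open>Geometry of the rotation group\<close>

lemma inner_eq_trace: "X \<bullet> Y = trace (transpose X ** Y)" for X Y :: "real^'n^'m"
proof -
  have "X \<bullet> Y = (\<Sum>k\<in>UNIV. \<Sum>i\<in>UNIV. X $ k $ i * Y $ k $ i)"
    by (simp add: inner_vec_def)
  also have "\<dots> = (\<Sum>i\<in>UNIV. \<Sum>k\<in>UNIV. X $ k $ i * Y $ k $ i)"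
    by (rule sum.swap)
  finally show ?thesis
    by (simp add: trace_def matrix_matrix_mult_def transpose_def)
qed

lemma dist_SO3_mult_left:
  fixes P Q :: "real^3^3"
  assumes "A \<in> SO3"
  shows "dist (A ** P) (A ** Q) = dist P Q"
proof -
  have "norm (A ** (P - Q)) = norm (P - Q)"
    unfolding norm_eq inner_eq_trace matrix_transpose_mul
    by (simp add: SO3_cancel[OF assms] flip: matrix_mul_assoc)
  moreover have "A ** (P - Q) = A ** P - A ** Q"
    by (simp add: vec_eq_iff matrix_matrix_mult_def right_diff_distrib sum_subtractf)
  ultimately show ?thesis
    by (simp add: dist_norm)
qed

text \<open>
  The Frobenius norm of a rotation is \<open>sqrt 3\<close>, and the inner product of \<open>Q\<close> and \<open>P\<close> is the trace of
  \<open>transpose Q ** P\<close>, which determines the rotation angle.  Hence Euclidean balls around \<open>Q\<close> are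
  exactly the sublevel sets of the slicing map \<open>slice Q\<close>.
\<close>

lemma dist_SO3_eq_slice:
  assumes Q: "Q \<in> SO3" and P: "P \<in> SO3"
  shows "dist Q P = sqrt (4 - 4 * cos (slice Q P))"
proof -
  have t: "trace (transpose Q ** P) \<in> {-1..3}"
    by (intro trace_SO3 SO3_mult SO3_transpose P Q)
  have self: "A \<bullet> A = 3" if "A \<in> SO3" for A
    using SO3_D(2)[OF that] by (simp add: inner_eq_trace trace_I)
  have "(dist Q P)\<^sup>2 = Q \<bullet> Q - 2 * (Q \<bullet> P) + P \<bullet> P"
    by (simp add: dist_norm power2_norm_eq_inner inner_diff inner_commute algebra_simps)
  also have "\<dots> = 6 - 2 * trace (transpose Q ** P)"
    by (simp add: self P Q) (simp add: inner_eq_trace)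
  also have "\<dots> = 4 - 4 * cos (slice Q P)"
    using t by (simp add: slice_def rot_angle_def cos_arccos field_simps)
  finally show ?thesis
    by (metis real_sqrt_unique zero_le_dist)
qed

lemma compact_SO3: "compact SO3"
proof (rule compact_eq_bounded_closed[THEN iffD2, OF conjI])
  have "dist (mat 1) P \<le> sqrt 8" if "P \<in> SO3" for P
    unfolding dist_SO3_eq_slice[OF SO3_one that] using cos_ge_minus_one[of "slice (mat 1) P"]
    by (intro real_sqrt_le_mono) linarith
  then show "bounded SO3"
    unfolding bounded_def by blast
qed (rule closed_SO3)

text \<open>
  Uniformity in \<open>P\<close> comes from compactness of the group.
\<close>

lemma slice_uniformly_continuous:
  assumes "0 < e"
  shows "\<exists>d>0. \<forall>Q\<in>SO3. \<forall>Q'\<in>SO3. dist Q' Q < d \<longrightarrow> (\<forall>P\<in>SO3. \<bar>slice Q' P - slice Q P\<bar> < e)"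
proof -
  have "trace (transpose (fst z) ** snd z) \<in> {-1..3}" if "z \<in> SO3 \<times> SO3" for z
    using that by (intro trace_SO3 SO3_mult SO3_transpose) auto
  then have "uniformly_continuous_on (SO3 \<times> SO3) (\<lambda>z. slice (fst z) (snd z))"
    unfolding slice_def rot_angle_def
    by (intro compact_uniformly_continuous compact_Times compact_SO3 continuous_intros) force+
  then obtain d where "0 < d"
    and d: "\<And>z z'. z \<in> SO3 \<times> SO3 \<Longrightarrow> z' \<in> SO3 \<times> SO3 \<Longrightarrow> dist z' z < d \<Longrightarrow>
      dist (slice (fst z') (snd z')) (slice (fst z) (snd z)) < e"
    unfolding uniformly_continuous_on_def using assms by metis
  have "\<bar>slice Q' P - slice Q P\<bar> < e" if "Q \<in> SO3" "Q' \<in> SO3" "dist Q' Q < d" "P \<in> SO3" for Q Q' P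
    using d[of "(Q, P)" "(Q', P)"] that by (simp add: dist_Pair_Pair dist_real_def)
  with \<open>0 < d\<close> show ?thesis by blast
qed


section \<open>Dependence on the slicing direction\<close>

lemma sets_slice_measure: "sets (slice_measure Q \<mu>) = sets (restrict_space borel {0..pi})"
  by (simp add: slice_measure_def)

lemma measurable_slice_borel_probs:
  assumes "Q \<in> SO3" "\<mu> \<in> borel_probs SO3"
  shows "slice Q \<in> \<mu> \<rightarrow>\<^sub>M restrict_space borel {0..pi}"
  using measurable_slice[OF assms(1)] measurable_cong_sets[OF borel_probs_D(2)[OF assms(2)] refl]
  by blast

text \<open>
  The pair \<open>(slice Q, slice Q')\<close> on the space of \<open>\<mu>\<close> is a coupling whose cost is bounded
  uniformly.
\<close>

lemma wasserstein_slice_measure_le: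
  assumes p: "0 < p" and Q: "Q \<in> SO3" "Q' \<in> SO3" and \<mu>: "\<mu> \<in> borel_probs SO3" and e: "0 \<le> e"
    and close: "\<And>P. P \<in> SO3 \<Longrightarrow> \<bar>slice Q P - slice Q' P\<bar> \<le> e"
  shows "wasserstein p (slice_measure Q \<mu>) (slice_measure Q' \<mu>) \<le> e"
proof -
  interpret prob_space \<mu> by (rule borel_probs_D(1)[OF \<mu>])
  have m: "slice R \<in> \<mu> \<rightarrow>\<^sub>M slice_measure R \<mu>" if "R \<in> SO3" for R
    using measurable_slice_borel_probs[OF that \<mu>] by (simp add: slice_measure_def)
  have d: "distr \<mu> (slice_measure R \<mu>) (slice R) = slice_measure R \<mu>" for R
    unfolding slice_measure_def by (intro distr_cong) simp_all
  have "wasserstein_pow p (slice_measure Q \<mu>) (slice_measure Q' \<mu>)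
      \<le> (\<integral>\<^sup>+ P. ennreal (\<bar>slice Q P - slice Q' P\<bar> powr p) \<partial>\<mu>)"
    by (intro wasserstein_pow_le_distr_Pair[OF _ m m d d sets_slice_measure sets_slice_measure]
        prob_space_axioms Q)
  also have "\<dots> \<le> (\<integral>\<^sup>+ P. ennreal (e powr p) \<partial>\<mu>)"
    using p close by (intro nn_integral_mono ennreal_leI powr_mono2) (auto simp: borel_probs_D(3)[OF \<mu>])
  also have "\<dots> = ennreal (e powr p)"
    by (simp add: emeasure_space_1)
  finally have "enn2real (wasserstein_pow p (slice_measure Q \<mu>) (slice_measure Q' \<mu>)) \<le> e powr p"
    by (metis enn2real_ennreal enn2real_mono ennreal_less_top powr_ge_zero)
  then have "wasserstein p (slice_measure Q \<mu>) (slice_measure Q' \<mu>) \<le> (e powr p) powr (1 / p)"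
    unfolding wasserstein_def using p by (intro powr_mono2) auto
  then show ?thesis
    using p e by (simp add: powr_powr)
qed

text \<open>
  Continuity in the slicing direction serves to make the integrand of the sliced distance
  measurable.
\<close>

lemma continuous_on_wasserstein_slice:
  assumes p: "1 \<le> p" and \<mu>: "\<mu> \<in> borel_probs SO3" and \<nu>: "\<nu> \<in> borel_probs SO3"
  shows "continuous_on SO3 (\<lambda>Q. wasserstein p (slice_measure Q \<mu>) (slice_measure Q \<nu>))"
proof (unfold continuous_on_iff, intro ballI allI impI)
  let ?w = "\<lambda>Q. wasserstein p (slice_measure Q \<mu>) (slice_measure Q \<nu>)"
  fix Q and e :: real assume Q: "Q \<in> SO3" and "0 < e"
  then obtain d where "0 < d"
    and d: "\<And>R R' P. R \<in> SO3 \<Longrightarrow> R' \<in> SO3 \<Longrightarrow> dist R' R < d \<Longrightarrow> P \<in> SO3 \<Longrightarrow>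
      \<bar>slice R' P - slice R P\<bar> < e / 3"
    using slice_uniformly_continuous[of "e / 3"] by auto
  note T = wasserstein_triangle[OF p] and S = slice_measure_in_borel_probs
  \<comment> \<open>Each of the two slices moves by at most \<open>e / 3\<close>, which leaves a margin for strictness.\<close>
  have step: "?w R' \<le> ?w R + 2 * (e / 3)" if R: "R \<in> SO3" "R' \<in> SO3" "dist R' R < d" for R R'
  proof -
    have "wasserstein p (slice_measure R' \<mu>) (slice_measure R \<mu>) \<le> e / 3"
      using p \<open>0 < e\<close> d[OF R] R by (intro wasserstein_slice_measure_le \<mu>) (auto intro: less_imp_le)
    moreover have "wasserstein p (slice_measure R \<nu>) (slice_measure R' \<nu>) \<le> e / 3"
      using p \<open>0 < e\<close> d[OF R(2,1)] R
      by (intro wasserstein_slice_measure_le \<nu>) (auto intro: less_imp_le simp: dist_commute)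
    moreover have "?w R' \<le> wasserstein p (slice_measure R' \<mu>) (slice_measure R \<mu>)
        + wasserstein p (slice_measure R \<mu>) (slice_measure R' \<nu>)"
      by (intro T S R \<mu> \<nu>)
    moreover have "wasserstein p (slice_measure R \<mu>) (slice_measure R' \<nu>)
        \<le> ?w R + wasserstein p (slice_measure R \<nu>) (slice_measure R' \<nu>)"
      by (intro T S R \<mu> \<nu>)
    ultimately show ?thesis by linarith
  qed
  have "dist (?w Q') (?w Q) < e" if "Q' \<in> SO3" "dist Q' Q < d" for Q'
    using step[OF Q that] step[OF that(1) Q] that \<open>0 < e\<close>
    unfolding dist_real_def by (simp add: dist_commute)
  with \<open>0 < d\<close> show "\<exists>d>0. \<forall>Q'\<in>SO3. dist Q' Q < d \<longrightarrow> dist (?w Q') (?w Q) < e"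
    by blast
qed

lemma haar_in_borel_probs: "haar_SO3 \<in> borel_probs SO3"
  using is_haar_haar_SO3 by (simp add: is_haar_def)

lemma measurable_wasserstein_pow_slice:
  assumes p: "1 \<le> p" and \<mu>: "\<mu> \<in> borel_probs SO3" and \<nu>: "\<nu> \<in> borel_probs SO3"
  shows "(\<lambda>Q. wasserstein_pow p (slice_measure Q \<mu>) (slice_measure Q \<nu>)) \<in> borel_measurable haar_SO3"
proof -
  have "(\<lambda>Q. wasserstein p (slice_measure Q \<mu>) (slice_measure Q \<nu>)) \<in> borel_measurable haar_SO3"
    using borel_measurable_continuous_on_restrict[OF continuous_on_wasserstein_slice[OF assms]]
      measurable_cong_sets[OF borel_probs_D(2)[OF haar_in_borel_probs] refl] by blast
  then have "(\<lambda>Q. ennreal (wasserstein p (slice_measure Q \<mu>) (slice_measure Q \<nu>) powr p))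
      \<in> borel_measurable haar_SO3"
    by measurable
  then show ?thesis
    using p by (subst measurable_cong[OF wasserstein_pow_eq])
      (auto simp: borel_probs_D(3)[OF haar_in_borel_probs] intro!: slice_measure_in_borel_probs \<mu> \<nu>)
qed


section \<open>Balls determine measures on the rotation group\<close>

text \<open>
  Consequently a slice of a measure records the mass of all balls around the slicing
  direction.
\<close>

lemma slice_measure_ball:
  assumes Q: "Q \<in> SO3" and \<mu>: "\<mu> \<in> borel_probs SO3"
  shows "emeasure \<mu> (ball Q r \<inter> SO3)
    = emeasure (slice_measure Q \<mu>) ({t. sqrt (4 - 4 * cos t) < r} \<inter> {0..pi})"
proof -
  have "{t. sqrt (4 - 4 * cos t) < r} \<in> sets borel"
    by measurable
  then have T: "{t. sqrt (4 - 4 * cos t) < r} \<inter> {0..pi} \<in> sets (restrict_space borel {0..pi})"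
    by (auto simp: sets_restrict_space)
  have "ball Q r \<inter> SO3 = slice Q -` ({t. sqrt (4 - 4 * cos t) < r} \<inter> {0..pi}) \<inter> space \<mu>"
    using slice_SO3[OF Q] dist_SO3_eq_slice[OF Q] by (auto simp: borel_probs_D(3)[OF \<mu>])
  then show ?thesis
    unfolding slice_measure_def
    using emeasure_distr[OF measurable_slice_borel_probs[OF Q \<mu>] T] by simp
qed

lemma haar_ball:
  assumes P: "P \<in> SO3"
  shows "emeasure haar_SO3 (ball P r \<inter> SO3) = emeasure haar_SO3 (ball (mat 1) r \<inter> SO3)"
proof -
  note H = haar_in_borel_probs
  have "(\<lambda>R. P ** R) ` (ball (mat 1) r \<inter> SO3) = ball P r \<inter> SO3"
  proof -
    have "transpose P ** R \<in> SO3 \<longleftrightarrow> R \<in> SO3" for R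
      using SO3_mult[OF SO3_transpose[OF P], of R] SO3_mult[OF P, of "transpose P ** R"]
      by (auto simp: SO3_cancel[OF P])
    moreover have "dist (mat 1) (transpose P ** R) = dist P R" for R
      using dist_SO3_mult_left[OF P, of "mat 1" "transpose P ** R"] by (simp add: SO3_cancel[OF P])
    ultimately show ?thesis
      by (subst translate_image_eq[OF P]) auto
  qed
  moreover have "translate P haar_SO3 = haar_SO3"
    using is_haar_haar_SO3 P by (simp add: is_haar_def)
  ultimately show ?thesis
    using emeasure_translate[OF P borel_probs_D(2)[OF H] borel_probs_Int_sets[OF H, of "ball (mat 1) r"]]
    by simp
qed

text \<open>
  Otherwise finitely many null balls, translates of one another, would cover the compact group.
\<close>

lemma haar_ball_pos:
  assumes "0 < r"
  shows "emeasure haar_SO3 (ball (mat 1) r \<inter> SO3) \<noteq> 0"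
proof
  assume zero: "emeasure haar_SO3 (ball (mat 1) r \<inter> SO3) = 0"
  note H = haar_in_borel_probs
  have "SO3 \<subseteq> (\<Union>P\<in>SO3. ball P r)"
    using \<open>0 < r\<close> by force
  then obtain K where K: "K \<subseteq> SO3" "finite K" "SO3 \<subseteq> (\<Union>P\<in>K. ball P r)"
    using compactE_image[OF compact_SO3, of SO3 "\<lambda>P. ball P r"] by auto
  have "ball P r \<inter> SO3 \<in> null_sets haar_SO3" if "P \<in> K" for P
    using haar_ball[of P r] K that zero borel_probs_Int_sets[OF H, of "ball P r"]
    by (auto simp: null_sets_def)
  then have "(\<Union>P\<in>K. ball P r \<inter> SO3) \<in> null_sets haar_SO3"
    using K(2) by (intro null_sets.finite_UN) auto
  moreover have "(\<Union>P\<in>K. ball P r \<inter> SO3) = SO3"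
    using K by blast
  ultimately have "emeasure haar_SO3 (space haar_SO3) = 0"
    by (simp add: null_sets_def borel_probs_D(3)[OF H])
  then show False
    using prob_space.emeasure_space_1[OF borel_probs_D(1)[OF H]] by simp
qed

text \<open>
  Average over the centres \<open>Q\<close>.  Let \<open>h\<close> be the Haar mass of a ball of radius \<open>r = e / 2\<close>, which does
  not depend on the centre, and \<open>U\<close> the \<open>r\<close>-thickening of \<open>C\<close>.  The integral over \<open>Q \<in> U\<close> of the
  \<open>m\<close>-mass of the \<open>r\<close>-ball around \<open>Q\<close> lies between \<open>h\<close> times the \<open>m\<close>-mass of \<open>C\<close> and \<open>h\<close> times the
  \<open>m\<close>-mass of the \<open>e\<close>-thickening, and it is the same for \<open>\<mu>\<close> and \<open>\<nu>\<close>.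
\<close>

lemma emeasure_le_thickening_if_balls_eq:
  fixes \<mu> \<nu> :: "(real^3^3) measure" and e :: real
  assumes \<mu>: "\<mu> \<in> borel_probs SO3" and \<nu>: "\<nu> \<in> borel_probs SO3"
    and eq: "AE Q in haar_SO3. \<forall>r. emeasure \<mu> (ball Q r \<inter> SO3) = emeasure \<nu> (ball Q r \<inter> SO3)"
    and C: "closed C" and e: "0 < e"
  shows "emeasure \<mu> (C \<inter> SO3) \<le> emeasure \<nu> ((\<Union>c\<in>C. ball c e) \<inter> SO3)"
proof -
  note H = haar_in_borel_probs
  interpret H: prob_space haar_SO3 by (rule borel_probs_D(1)[OF H])
  \<comment> \<open>With radius \<open>e / 2\<close>, two steps lead from \<open>C\<close> to within \<open>e\<close> of \<open>C\<close>.\<close>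
  define r where "r = e / 2"
  define U where "U = (\<Union>c\<in>C. ball c r)"
  define U' where "U' = (\<Union>c\<in>C. ball c e)"
  define h where "h = emeasure haar_SO3 (ball (mat 1) r \<inter> SO3)"
  define J where "J m = (\<integral>\<^sup>+ P. \<integral>\<^sup>+ Q. indicator U Q * indicator (ball P r) Q \<partial>haar_SO3 \<partial>m)"
    for m :: "(real^3^3) measure"
  have h: "h \<noteq> 0" "h < \<infinity>"
    using e haar_ball_pos[of r] by (auto simp: h_def r_def less_top[symmetric])
  have U: "U \<in> sets borel" and U': "U' \<in> sets borel"
    unfolding U_def U'_def by (intro borel_open open_UN, simp)+
  have ball: "(\<integral>\<^sup>+ Q. indicator (ball P r) Q \<partial>m) = emeasure m (ball P r \<inter> SO3)"
    if m: "m \<in> borel_probs SO3" for m and P :: "real^3^3"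
  proof -
    have "(\<integral>\<^sup>+ Q. indicator (ball P r) Q \<partial>m) = (\<integral>\<^sup>+ Q. indicator (ball P r \<inter> SO3) Q \<partial>m)"
      by (intro nn_integral_cong) (auto simp: borel_probs_D(3)[OF m] split: split_indicator)
    then show ?thesis
      using borel_probs_Int_sets[OF m, of "ball P r"] by simp
  qed
  \<comment> \<open>If \<open>P\<close> lies in \<open>C\<close>, then the ball around \<open>P\<close> lies in \<open>U\<close> and the inner integral of \<open>J\<close> is \<open>h\<close>.\<close>
  have lower: "emeasure m (C \<inter> SO3) * h \<le> J m" if m: "m \<in> borel_probs SO3" for m
  proof -
    have CS: "C \<inter> SO3 \<in> sets m"
      using C by (intro borel_probs_Int_sets[OF m]) simp
    have "emeasure m (C \<inter> SO3) * h = (\<integral>\<^sup>+ P. indicator (C \<inter> SO3) P * h \<partial>m)"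
      using CS by (simp add: nn_integral_multc)
    also have "\<dots> \<le> J m"
      unfolding J_def
    proof (rule nn_integral_mono)
      fix P assume "P \<in> space m"
      show "indicator (C \<inter> SO3) P * h
          \<le> (\<integral>\<^sup>+ Q. indicator U Q * indicator (ball P r) Q \<partial>haar_SO3)"
      proof (cases "P \<in> C \<inter> SO3")
        case True
        then have "ball P r \<subseteq> U" by (auto simp: U_def)
        then have "(\<integral>\<^sup>+ Q. indicator U Q * indicator (ball P r) Q \<partial>haar_SO3)
            = (\<integral>\<^sup>+ Q. indicator (ball P r) Q \<partial>haar_SO3)"
          by (intro nn_integral_cong) (auto split: split_indicator)
        then show ?thesis
          using True by (simp add: ball[OF H] haar_ball h_def)
      qed simp
    qed
    finally show ?thesis .
  qed
  \<comment> \<open>If \<open>P\<close> lies outside \<open>U'\<close>, then the ball around \<open>P\<close> misses \<open>U\<close>.\<close>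
  have upper: "J m \<le> emeasure m (U' \<inter> SO3) * h" if m: "m \<in> borel_probs SO3" for m
  proof -
    have US: "U' \<inter> SO3 \<in> sets m"
      using U' by (rule borel_probs_Int_sets[OF m])
    have "J m \<le> (\<integral>\<^sup>+ P. indicator (U' \<inter> SO3) P * h \<partial>m)"
      unfolding J_def
    proof (rule nn_integral_mono)
      fix P assume "P \<in> space m"
      then have P: "P \<in> SO3" by (simp add: borel_probs_D(3)[OF m])
      show "(\<integral>\<^sup>+ Q. indicator U Q * indicator (ball P r) Q \<partial>haar_SO3)
          \<le> indicator (U' \<inter> SO3) P * h"
      proof (cases "P \<in> U'")
        case True
        have "(\<integral>\<^sup>+ Q. indicator U Q * indicator (ball P r) Q \<partial>haar_SO3)
            \<le> (\<integral>\<^sup>+ Q. indicator (ball P r) Q \<partial>haar_SO3)"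
          by (intro nn_integral_mono) (auto split: split_indicator)
        then show ?thesis
          using True P by (simp add: ball[OF H] haar_ball h_def)
      next
        case False
        have "Q \<notin> ball P r" if Q: "Q \<in> U" for Q
        proof
          assume "Q \<in> ball P r"
          moreover obtain c where "c \<in> C" "dist c Q < r"
            using Q by (auto simp: U_def)
          ultimately have "P \<in> U'"
            using dist_triangle2[of c P Q] by (auto simp: U'_def r_def intro!: bexI[of _ c])
          with False show False ..
        qed
        then have "(\<integral>\<^sup>+ Q. indicator U Q * indicator (ball P r) Q \<partial>haar_SO3)
            = (\<integral>\<^sup>+ Q. 0 \<partial>haar_SO3)"
          by (intro nn_integral_cong) (auto split: split_indicator)
        then show ?thesis by simp
      qed
    qed
    also have "\<dots> = emeasure m (U' \<inter> SO3) * h"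
      using US by (simp add: nn_integral_multc)
    finally show ?thesis .
  qed
  \<comment> \<open>After the exchange, \<open>J m\<close> involves \<open>m\<close> only through the masses of balls.\<close>
  have Fubini: "J m = (\<integral>\<^sup>+ Q. indicator U Q * emeasure m (ball Q r \<inter> SO3) \<partial>haar_SO3)"
    if m: "m \<in> borel_probs SO3" for m
  proof -
    interpret M: prob_space m by (rule borel_probs_D(1)[OF m])
    interpret MH: pair_prob_space m haar_SO3 ..
    note [measurable] =
      measurable_restrict_borel_D[OF borel_probs_D(2)[OF m] measurable_fst[of m haar_SO3]]
      measurable_restrict_borel_D[OF borel_probs_D(2)[OF H] measurable_snd[of m haar_SO3]] U
    have "(\<lambda>(P, Q). indicator U Q * indicator {z. dist (fst z) (snd z) < r} (P, Q) :: ennreal)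
        \<in> borel_measurable (m \<Otimes>\<^sub>M haar_SO3)"
      unfolding split_beta' by measurable
    also have "(\<lambda>(P, Q). indicator U Q * indicator {z. dist (fst z) (snd z) < r} (P, Q) :: ennreal)
        = (\<lambda>(P, Q). indicator U Q * indicator (ball P r) Q)"
      by (auto simp: fun_eq_iff split: split_indicator)
    finally have "J m = (\<integral>\<^sup>+ Q. \<integral>\<^sup>+ P. indicator U Q * indicator (ball P r) Q \<partial>m \<partial>haar_SO3)"
      unfolding J_def by (rule MH.Fubini'[symmetric])
    also have "\<dots> = (\<integral>\<^sup>+ Q. indicator U Q * (\<integral>\<^sup>+ P. indicator (ball Q r) P \<partial>m) \<partial>haar_SO3)"
    proof (intro nn_integral_cong)
      fix Q
      have "(\<lambda>P. P) \<in> borel_measurable m"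
        by (rule measurable_restrict_borel_D[OF borel_probs_D(2)[OF m] measurable_ident_sets[OF refl]])
      then have "(\<lambda>P. indicator (ball Q r) P :: ennreal) \<in> borel_measurable m"
        by (rule measurable_compose) (intro borel_measurable_indicator, simp)
      then have "indicator U Q * (\<integral>\<^sup>+ P. indicator (ball Q r) P \<partial>m)
          = (\<integral>\<^sup>+ P. indicator U Q * indicator (ball Q r) P \<partial>m)"
        by (intro nn_integral_cmult[symmetric])
      also have "\<dots> = (\<integral>\<^sup>+ P. indicator U Q * indicator (ball P r) Q \<partial>m)"
        by (intro nn_integral_cong) (auto simp: dist_commute split: split_indicator)
      finally show "(\<integral>\<^sup>+ P. indicator U Q * indicator (ball P r) Q \<partial>m)
          = indicator U Q * (\<integral>\<^sup>+ P. indicator (ball Q r) P \<partial>m)" ..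
    qed
    finally show ?thesis by (simp add: ball[OF m])
  qed
  have "J \<mu> = J \<nu>"
    unfolding Fubini[OF \<mu>] Fubini[OF \<nu>] using eq by (intro nn_integral_cong_AE) auto
  then have "emeasure \<mu> (C \<inter> SO3) * h \<le> emeasure \<nu> (U' \<inter> SO3) * h"
    using lower[OF \<mu>] upper[OF \<nu>] by simp
  then show ?thesis
    using h unfolding U'_def[symmetric]
    by (metis ennreal_mult_le_mult_iff mult.commute infinity_ennreal_def less_irrefl)
qed

lemma borel_probs_SO3_eqI_balls:
  assumes \<mu>: "\<mu> \<in> borel_probs SO3" and \<nu>: "\<nu> \<in> borel_probs SO3"
    and eq: "AE Q in haar_SO3. \<forall>r. emeasure \<mu> (ball Q r \<inter> SO3) = emeasure \<nu> (ball Q r \<inter> SO3)"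
  shows "\<mu> = \<nu>"
proof -
  have "AE Q in haar_SO3. \<forall>r. emeasure \<nu> (ball Q r \<inter> SO3) = emeasure \<mu> (ball Q r \<inter> SO3)"
    using eq by (rule AE_mp) (intro AE_I2, simp)
  then show ?thesis
    by (intro borel_probs_eqI_closed[OF SO3_borel \<mu> \<nu>] emeasure_le_thickening_if_balls_eq \<mu> \<nu> eq)
qed


section \<open>The sliced Wasserstein distance\<close>

lemma SOSW_pow_eq_0D:
  assumes p: "1 \<le> p" and \<mu>: "\<mu> \<in> borel_probs SO3" and \<nu>: "\<nu> \<in> borel_probs SO3"
    and zero: "SOSW_pow p \<mu> \<nu> = 0"
  shows "\<mu> = \<nu>"
proof (rule borel_probs_SO3_eqI_balls[OF \<mu> \<nu>])
  have "AE Q in haar_SO3. wasserstein_pow p (slice_measure Q \<mu>) (slice_measure Q \<nu>) = 0"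
    using zero measurable_wasserstein_pow_slice[OF p \<mu> \<nu>]
    unfolding SOSW_pow_def by (simp add: nn_integral_0_iff_AE)
  then show "AE Q in haar_SO3. \<forall>r. emeasure \<mu> (ball Q r \<inter> SO3) = emeasure \<nu> (ball Q r \<inter> SO3)"
  proof (rule AE_mp, intro AE_I2 impI allI)
    fix Q r assume "Q \<in> space haar_SO3"
      and zero: "wasserstein_pow p (slice_measure Q \<mu>) (slice_measure Q \<nu>) = 0"
    then have Q: "Q \<in> SO3" by (simp add: borel_probs_D(3)[OF haar_in_borel_probs])
    have "slice_measure Q \<mu> = slice_measure Q \<nu>"
      using p by (intro wasserstein_pow_eq_0D[OF _ _ _ _ zero, of "{0..pi}"]
          slice_measure_in_borel_probs Q \<mu> \<nu>) auto
    then show "emeasure \<mu> (ball Q r \<inter> SO3) = emeasure \<nu> (ball Q r \<inter> SO3)"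
      by (simp add: slice_measure_ball Q \<mu> \<nu>)
  qed
qed

text \<open>
  The weighted inequality holds for each slice and has fixed coefficients, so it survives
  integration over the slicing direction.
\<close>

lemma SOSW_triangle:
  assumes p: "1 \<le> p"
    and \<mu>: "\<mu> \<in> borel_probs SO3" and \<nu>: "\<nu> \<in> borel_probs SO3" and \<rho>: "\<rho> \<in> borel_probs SO3"
  shows "SOSW p \<mu> \<rho> \<le> SOSW p \<mu> \<nu> + SOSW p \<nu> \<rho>"
  unfolding SOSW_def
proof (rule enn2real_powr_triangleI[OF p])
  fix l :: real assume l: "0 < l" "l < 1"
  let ?W = "\<lambda>\<mu> \<nu> Q. wasserstein_pow p (slice_measure Q \<mu>) (slice_measure Q \<nu>)"
  have "SOSW_pow p \<mu> \<rho> \<le> (\<integral>\<^sup>+ Q. ennreal (l powr (1 - p)) * ?W \<mu> \<nu> Q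
      + ennreal ((1 - l) powr (1 - p)) * ?W \<nu> \<rho> Q \<partial>haar_SO3)"
    unfolding SOSW_pow_def
    by (intro nn_integral_mono wasserstein_pow_triangle p l slice_measure_in_borel_probs \<mu> \<nu> \<rho>)
      (simp_all add: borel_probs_D(3)[OF haar_in_borel_probs])
  also have "\<dots> = ennreal (l powr (1 - p)) * SOSW_pow p \<mu> \<nu>
      + ennreal ((1 - l) powr (1 - p)) * SOSW_pow p \<nu> \<rho>"
    using measurable_wasserstein_pow_slice[OF p \<mu> \<nu>] measurable_wasserstein_pow_slice[OF p \<nu> \<rho>]
    by (simp add: nn_integral_add nn_integral_cmult SOSW_pow_def)
  finally show "SOSW_pow p \<mu> \<rho> \<le> ennreal (l powr (1 - p)) * SOSW_pow p \<mu> \<nu>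
      + ennreal ((1 - l) powr (1 - p)) * SOSW_pow p \<nu> \<rho>" .
qed (use p SOSW_pow_finite \<mu> \<nu> \<rho> in auto)

text \<open>
  Slicing a translate amounts to slicing the original measure in a translated direction.
\<close>

lemma slice_measure_translate:
  assumes A: "A \<in> SO3" and Q: "Q \<in> SO3" and \<mu>: "\<mu> \<in> borel_probs SO3"
  shows "slice_measure Q (translate A \<mu>) = slice_measure (A ** Q) \<mu>"
proof -
  note s = borel_probs_D(2)[OF \<mu>]
  have "slice_measure Q (translate A \<mu>)
      = distr \<mu> (restrict_space borel {0..pi}) (slice Q \<circ> (\<lambda>P. transpose A ** P))"
    unfolding slice_measure_def translate_eq_distr[OF A s]
    by (rule distr_distr[OF measurable_slice_borel_probs[OF Q \<mu>]
          measurable_mult_sets_SO3(1)[OF SO3_transpose[OF A] s]])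
  also have "slice Q \<circ> (\<lambda>P. transpose A ** P) = slice (A ** Q)"
    by (simp add: fun_eq_iff slice_def matrix_transpose_mul matrix_mul_assoc)
  finally show ?thesis by (simp add: slice_measure_def)
qed

lemma nn_integral_haar_mult_left:
  assumes A: "A \<in> SO3" and f: "f \<in> borel_measurable haar_SO3"
  shows "(\<integral>\<^sup>+ Q. f (A ** Q) \<partial>haar_SO3) = (\<integral>\<^sup>+ Q. f Q \<partial>haar_SO3)"
proof -
  note s = borel_probs_D(2)[OF haar_in_borel_probs]
  have "haar_SO3 = translate (transpose A) haar_SO3"
    using is_haar_haar_SO3 SO3_transpose[OF A] by (simp add: is_haar_def)
  also have "\<dots> = distr haar_SO3 haar_SO3 (\<lambda>Q. A ** Q)"
    using translate_eq_distr[OF SO3_transpose[OF A] s] by simp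
  finally have eq: "distr haar_SO3 haar_SO3 (\<lambda>Q. A ** Q) = haar_SO3" ..
  have "(\<integral>\<^sup>+ Q. f Q \<partial>distr haar_SO3 haar_SO3 (\<lambda>Q. A ** Q)) = (\<integral>\<^sup>+ Q. f (A ** Q) \<partial>haar_SO3)"
    using f by (intro nn_integral_distr measurable_mult_sets_SO3(1)[OF A s]) simp
  then show ?thesis by (simp only: eq)
qed

lemma SOSW_pow_translate:
  assumes p: "1 \<le> p" and A: "A \<in> SO3" and \<mu>: "\<mu> \<in> borel_probs SO3" and \<nu>: "\<nu> \<in> borel_probs SO3"
  shows "SOSW_pow p (translate A \<mu>) (translate A \<nu>) = SOSW_pow p \<mu> \<nu>"
proof -
  have "SOSW_pow p (translate A \<mu>) (translate A \<nu>)
      = (\<integral>\<^sup>+ Q. wasserstein_pow p (slice_measure (A ** Q) \<mu>) (slice_measure (A ** Q) \<nu>) \<partial>haar_SO3)"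
    unfolding SOSW_pow_def
    by (intro nn_integral_cong)
      (simp add: slice_measure_translate A \<mu> \<nu> borel_probs_D(3)[OF haar_in_borel_probs])
  also have "\<dots> = SOSW_pow p \<mu> \<nu>"
    unfolding SOSW_pow_def
    by (rule nn_integral_haar_mult_left[OF A measurable_wasserstein_pow_slice[OF p \<mu> \<nu>]])
  finally show ?thesis .
qed

theorem theorem4p8:
  fixes p :: real
  assumes "1 \<le> p"
  shows "Metric_space (borel_probs SO3) (SOSW p) \<and>
    (\<forall>A\<in>SO3. \<forall>\<mu>\<in>borel_probs SO3. \<forall>\<nu>\<in>borel_probs SO3.
       SOSW_pow p (translate A \<mu>) (translate A \<nu>) = SOSW_pow p \<mu> \<nu>)"
proof (intro conjI ballI SOSW_pow_translate assms)
  show "Metric_space (borel_probs SO3) (SOSW p)"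
  proof
    show "0 \<le> SOSW p \<mu> \<nu>" for \<mu> \<nu>
      by (simp add: SOSW_def)
    show "SOSW p \<mu> \<nu> = SOSW p \<nu> \<mu>" for \<mu> \<nu>
      unfolding SOSW_def SOSW_pow_def
      by (simp add: wasserstein_pow_commute[OF sets_slice_measure sets_slice_measure])
    show "SOSW p \<mu> \<nu> = 0 \<longleftrightarrow> \<mu> = \<nu>" if "\<mu> \<in> borel_probs SO3" "\<nu> \<in> borel_probs SO3" for \<mu> \<nu>
    proof
      assume "SOSW p \<mu> \<nu> = 0"
      then have "SOSW_pow p \<mu> \<nu> = 0"
        using assms that SOSW_pow_finite[of p \<mu> \<nu>] by (auto simp: SOSW_def enn2real_eq_0_iff)
      then show "\<mu> = \<nu>"
        by (rule SOSW_pow_eq_0D[OF assms that])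
    next
      assume "\<mu> = \<nu>"
      then have "SOSW_pow p \<mu> \<nu> = (\<integral>\<^sup>+ Q. 0 \<partial>haar_SO3)"
        unfolding SOSW_pow_def using assms that
        by (intro nn_integral_cong)
          (simp add: wasserstein_pow_self[OF slice_measure_in_borel_probs]
            borel_probs_D(3)[OF haar_in_borel_probs])
      then show "SOSW p \<mu> \<nu> = 0"
        by (simp add: SOSW_def)
    qed
    show "SOSW p \<mu> \<rho> \<le> SOSW p \<mu> \<nu> + SOSW p \<nu> \<rho>"
      if "\<mu> \<in> borel_probs SO3" "\<nu> \<in> borel_probs SO3" "\<rho> \<in> borel_probs SO3" for \<mu> \<nu> \<rho>
      by (rule SOSW_triangle[OF assms that])
  qed
qed

end
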